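(* Let $m\ge d\ge 1$. Let $G=(V,E)$ be a graph and $V_1,\dots,V_m$ a partition of $V$ into nonempty sets. For each $i\in[m]$ let $k_i\ge 1$ and let $V_{i1},\dots,V_{ik_i}$ be a partition of $V_i$. Assume: (a) the reduced graph $G'$ associated with the partition $V_1,\dots,V_m$ is $d$-rigid; (b) for every $i\in[m]$, $G[V_i]$ contains a forest $F_i$ such that the multigraph obtained from $F_i$ by contracting each set $V_{ij}$, $1\le j\le k_i$, to a single vertex (keeping parallel edges and deleting loops) contains $d$ edge-disjoint spanning trees; (c) for every $i\in[m]$ and $j\in[k_i]$, the graph $Q_{ij}=(V_{ij},E'_{ij})$ is connected, where $E'_{ij}$ consists of all pairs $u,v\in V_{ij}$ for which there are at least $d$ distinct indices $s\in[m]\setminus\{i\}$ such that $u$ and $v$ are connected by a path in $G[V_i,V_s]$. Then $G$ is $d$-rigid.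
   Context: The reduced graph is $G'=([m],E')$ with $\{i,j\}\in E'$ iff $G$ has an edge between $V_i$ and $V_j$. For disjoint $A,B$, $G[A,B]$ is the bipartite graph on $A\cup B$ of edges of $G$ between $A$ and $B$. A $d$-dimensional framework $(G,\mathbf{p})$ is rigid if every continuous edge-length-preserving motion of the vertices starting at $\mathbf{p}$ preserves all pairwise distances; $\mathbf{p}$ is generic if its coordinates are algebraically independent over $\mathbb{Q}$; a graph is $d$-rigid if $(G,\mathbf{p})$ is rigid for some (equivalently, every) generic $\mathbf{p}:V\to\mathbb{R}^d$. *)

theory Defs
  imports "HOL-Analysis.Analysis" "HOL-Library.Poly_Mapping" "HOL-Library.Disjoint_Sets"
begin

definition simple_graph :: "'v set \<Rightarrow> 'v set set \<Rightarrow> bool" where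
  "simple_graph V E \<longleftrightarrow> finite V \<and> (\<forall>e\<in>E. e \<subseteq> V \<and> card e = 2)"

definition induced_edges :: "'v set set \<Rightarrow> 'v set \<Rightarrow> 'v set set" where
  "induced_edges E X = {e \<in> E. e \<subseteq> X}"

definition edges_between :: "'v set set \<Rightarrow> 'v set \<Rightarrow> 'v set \<Rightarrow> 'v set set" where
  "edges_between E A B = {{a, b} | a b. a \<in> A \<and> b \<in> B \<and> {a, b} \<in> E}"

definition indexed_partition :: "'v set \<Rightarrow> nat \<Rightarrow> (nat \<Rightarrow> 'v set) \<Rightarrow> bool" where
  "indexed_partition X n P \<longleftrightarrow>
     (\<forall>i\<in>{1..n}. P i \<noteq> {}) \<and> disjoint_family_on P {1..n} \<and> (\<Union>i\<in>{1..n}. P i) = X"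

definition reduced_edges :: "'v set set \<Rightarrow> nat \<Rightarrow> (nat \<Rightarrow> 'v set) \<Rightarrow> nat set set" where
  "reduced_edges E m P =
     {{i, j} | i j. i \<in> {1..m} \<and> j \<in> {1..m} \<and> i \<noteq> j \<and> edges_between E (P i) (P j) \<noteq> {}}"

(* A multigraph is given by a vertex set N, an edge set A and a map ends sending each edge
   to its set of endpoints (a singleton for a loop). A simple graph is the case ends = id. *)

definition mg_path :: "('e \<Rightarrow> 'n set) \<Rightarrow> 'e set \<Rightarrow> 'n list \<Rightarrow> 'e list \<Rightarrow> bool" where
  "mg_path ends A vs es \<longleftrightarrow>
     length vs = Suc (length es) \<and> distinct vs \<and> set es \<subseteq> A \<and>
     (\<forall>i<length es. ends (es ! i) = {vs ! i, vs ! Suc i})"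

definition mg_linked :: "('e \<Rightarrow> 'n set) \<Rightarrow> 'e set \<Rightarrow> 'n \<Rightarrow> 'n \<Rightarrow> bool" where
  "mg_linked ends A u v \<longleftrightarrow> (\<exists>vs es. mg_path ends A vs es \<and> hd vs = u \<and> last vs = v)"

definition mg_connected :: "'n set \<Rightarrow> ('e \<Rightarrow> 'n set) \<Rightarrow> 'e set \<Rightarrow> bool" where
  "mg_connected N ends A \<longleftrightarrow> (\<forall>u\<in>N. \<forall>v\<in>N. mg_linked ends A u v)"

(* Cycles of length 1 (loops) and of length 2 (pairs of parallel edges) are included. *)
definition mg_cycle :: "('e \<Rightarrow> 'n set) \<Rightarrow> 'e set \<Rightarrow> 'n list \<Rightarrow> 'e list \<Rightarrow> bool" where
  "mg_cycle ends A vs es \<longleftrightarrow>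
     es \<noteq> [] \<and> length vs = length es \<and> distinct vs \<and> distinct es \<and> set es \<subseteq> A \<and>
     (\<forall>i<length es. ends (es ! i) = {vs ! i, vs ! (Suc i mod length es)})"

definition mg_forest :: "('e \<Rightarrow> 'n set) \<Rightarrow> 'e set \<Rightarrow> bool" where
  "mg_forest ends A \<longleftrightarrow> (\<nexists>vs es. mg_cycle ends A vs es)"

definition mg_spanning_tree :: "'n set \<Rightarrow> ('e \<Rightarrow> 'n set) \<Rightarrow> 'e set \<Rightarrow> 'e set \<Rightarrow> bool" where
  "mg_spanning_tree N ends A T \<longleftrightarrow> T \<subseteq> A \<and> mg_connected N ends T \<and> mg_forest ends T"

(* The trees are an indexed family: on a single vertex all of them are edgeless and coincide. *)
definition has_disjoint_spanning_trees ::
  "nat \<Rightarrow> 'n set \<Rightarrow> ('e \<Rightarrow> 'n set) \<Rightarrow> 'e set \<Rightarrow> bool" where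
  "has_disjoint_spanning_trees d N ends A \<longleftrightarrow>
     (\<exists>T. (\<forall>t\<in>{1..d}. mg_spanning_tree N ends A (T t)) \<and> disjoint_family_on T {1..d})"

(* Contracting P 1, ..., P k gives a multigraph on {1..k}. Its edges are the original edges
   themselves, which keeps parallel edges apart; those inside one part (loops) are removed. *)

definition contract_edges :: "nat \<Rightarrow> (nat \<Rightarrow> 'v set) \<Rightarrow> 'v set set \<Rightarrow> 'v set set" where
  "contract_edges k P F = {e \<in> F. \<not> (\<exists>j\<in>{1..k}. e \<subseteq> P j)}"

definition contract_ends :: "nat \<Rightarrow> (nat \<Rightarrow> 'v set) \<Rightarrow> 'v set \<Rightarrow> nat set" where
  "contract_ends k P e = {j \<in> {1..k}. e \<inter> P j \<noteq> {}}"

(* Pairs in the part W of P i joined inside at least d of the bipartite graphs G[P i, P s]. *)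
definition Q_edges ::
  "nat \<Rightarrow> 'v set set \<Rightarrow> nat \<Rightarrow> (nat \<Rightarrow> 'v set) \<Rightarrow> nat \<Rightarrow> 'v set \<Rightarrow> 'v set set" where
  "Q_edges d E m P i W =
     {{u, v} | u v. u \<in> W \<and> v \<in> W \<and> u \<noteq> v \<and>
        d \<le> card {s \<in> {1..m} - {i}. mg_linked id (edges_between E (P i) (P s)) u v}}"

(* Evaluation of the polynomial with rational coefficients whose monomials are the finitely
   supported exponent vectors in keys f. *)
definition eval_rat_mpoly :: "('i \<Rightarrow> real) \<Rightarrow> (('i \<Rightarrow>\<^sub>0 nat) \<Rightarrow>\<^sub>0 rat) \<Rightarrow> real" where
  "eval_rat_mpoly x f =
     (\<Sum>a\<in>Poly_Mapping.keys f. of_rat (Poly_Mapping.lookup f a) *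
        (\<Prod>i\<in>Poly_Mapping.keys a. x i ^ Poly_Mapping.lookup a i))"

definition alg_independent_rat :: "'i set \<Rightarrow> ('i \<Rightarrow> real) \<Rightarrow> bool" where
  "alg_independent_rat I x \<longleftrightarrow>
     (\<forall>f. (\<forall>a\<in>Poly_Mapping.keys f. Poly_Mapping.keys a \<subseteq> I) \<longrightarrow>
        eval_rat_mpoly x f = 0 \<longrightarrow> f = 0)"

definition generic :: "'v set \<Rightarrow> ('v \<Rightarrow> real ^ 'd) \<Rightarrow> bool" where
  "generic V p \<longleftrightarrow> alg_independent_rat (V \<times> UNIV) (\<lambda>(v, c). p v $ c)"

definition rigid_framework :: "'v set \<Rightarrow> 'v set set \<Rightarrow> ('v \<Rightarrow> real ^ 'd) \<Rightarrow> bool" where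
  "rigid_framework V E p \<longleftrightarrow>
     (\<forall>q :: real \<Rightarrow> 'v \<Rightarrow> real ^ 'd.
        (\<forall>v\<in>V. continuous_on {0..1} (\<lambda>t. q t v)) \<longrightarrow>
        (\<forall>v\<in>V. q 0 v = p v) \<longrightarrow>
        (\<forall>t\<in>{0..1}. \<forall>u v. {u, v} \<in> E \<longrightarrow> dist (q t u) (q t v) = dist (p u) (p v)) \<longrightarrow>
        (\<forall>t\<in>{0..1}. \<forall>u\<in>V. \<forall>v\<in>V. dist (q t u) (q t v) = dist (p u) (p v)))"

(* The dimension d is CARD('d), passed as TYPE('d). *)
definition d_rigid :: "'d::finite itself \<Rightarrow> 'v set \<Rightarrow> 'v set set \<Rightarrow> bool" where
  "d_rigid _ V E \<longleftrightarrow> (\<exists>p :: 'v \<Rightarrow> real ^ 'd. generic V p \<and> rigid_framework V E p)"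

end

theory Submission
  imports Defs "Jordan_Normal_Form.Determinant"
begin

text \<open>
  Length constraints are quadratic, and \<open>|q|\<^sup>2 - |p|\<^sup>2 = (q + p) \<bullet> (q - p)\<close>: two placements give an
  edge the same length iff their difference is orthogonal to the row of that edge in the rigidity
  matrix at their midpoint. Being independent is a polynomial condition on rows (a Gram determinant),
  so at a generic placement the rows of any edge set have maximal rank. Together these give the
  equivalence of rigidity and infinitesimal rigidity at generic placements without any
  differentiability of motions.

  Given a generic infinitesimally rigid placement \<open>p\<close> of the reduced graph, put \<open>v \<in> V\<^sub>i\<close> at
  \<open>p i + \<epsilon> x v\<close>, where \<open>x\<close> is chosen so that each edge of the \<open>c\<close>-th spanning tree in \<open>V\<^sub>i\<close> is parallel
  to the \<open>c\<close>-th axis; this is possible because the trees lie in a forest. In the limit \<open>\<epsilon> \<rightarrow> 0\<close> a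
  velocity preserving all lengths is constant on each \<open>V\<^sub>i\<^sub>j\<close> by (c), as any \<open>d\<close> of the directions
  \<open>p s - p i\<close> span; then constant on \<open>V\<^sub>i\<close> by the spanning trees; hence it is a velocity of the
  reduced graph, i.e. of the form \<open>v \<mapsto> A (p i) + b\<close> with \<open>A\<close> skew. If it also has no linear and no
  angular momentum, it vanishes. This nondegeneracy is open, so it survives for small \<open>\<epsilon> \<noteq> 0\<close> and then
  for generic placements.
\<close>

no_notation Matrix.vec_index (infixl "$" 100)
no_notation Matrix.scalar_prod (infix "\<bullet>" 70)

section \<open>Linear independence of finite families\<close>

text \<open>Independence of an indexed family rather than of a set of vectors, so that equal rows at
  different indices count as dependent.\<close>

definition lin_indep :: "'s set \<Rightarrow> 'j set \<Rightarrow> ('s \<Rightarrow> 'j \<Rightarrow> real) \<Rightarrow> bool" where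
  "lin_indep S J a \<longleftrightarrow> (\<forall>c. (\<forall>j\<in>J. (\<Sum>s\<in>S. c s * a s j) = 0) \<longrightarrow> (\<forall>s\<in>S. c s = 0))"

lemma lin_indepI:
  assumes "\<And>c s. (\<And>j. j \<in> J \<Longrightarrow> (\<Sum>s\<in>S. c s * a s j) = 0) \<Longrightarrow> s \<in> S \<Longrightarrow> c s = 0"
  shows "lin_indep S J a"
  using assms unfolding lin_indep_def by blast

lemma lin_indepD:
  assumes "lin_indep S J a" "\<And>j. j \<in> J \<Longrightarrow> (\<Sum>s\<in>S. c s * a s j) = 0" "s \<in> S"
  shows "c s = 0"
  using assms unfolding lin_indep_def by blast

text \<open>The determinant of a matrix indexed by an arbitrary finite set. The same enumeration
  orders rows and columns, so the value does not depend on its choice.\<close>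

definition fdet :: "'s set \<Rightarrow> ('s \<Rightarrow> 's \<Rightarrow> real) \<Rightarrow> real" where
  "fdet S G = (let \<sigma> = (SOME h. bij_betw h {0..<card S} S) in
     Determinant.det (mat (card S) (card S) (\<lambda>(k, l). G (\<sigma> k) (\<sigma> l))))"

text \<open>The Leibniz formula with one enumeration serving every \<open>G\<close>; polynomiality
  and continuity in the entries can be read off from it.\<close>

lemma fdet_expand:
  "\<exists>\<sigma>. (finite S \<longrightarrow> bij_betw \<sigma> {0..<card S} S) \<and>
       (\<forall>G. fdet S G = (\<Sum>\<pi> | \<pi> permutes {0..<card S}.
          of_int (sign \<pi>) * (\<Prod>i = 0..<card S. G (\<sigma> i) (\<sigma> (\<pi> i)))))"
proof -
  define \<sigma> where "\<sigma> = (SOME h. bij_betw h {0..<card S} S)"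
  have "bij_betw \<sigma> {0..<card S} S" if "finite S"
    unfolding \<sigma>_def using ex_bij_betw_nat_finite[OF that] by (rule someI_ex)
  moreover have "fdet S G = (\<Sum>\<pi> | \<pi> permutes {0..<card S}.
          of_int (sign \<pi>) * (\<Prod>i = 0..<card S. G (\<sigma> i) (\<sigma> (\<pi> i))))" for G
    unfolding fdet_def Let_def \<sigma>_def[symmetric] det_def'[OF mat_carrier]
    by (intro sum.cong prod.cong refl arg_cong2[where f="(*)"], subst index_mat)
       (use permutes_in_image in fastforce)+
  ultimately show ?thesis by blast
qed

lemma fdet_cong:
  assumes "\<And>s t. s \<in> S \<Longrightarrow> t \<in> S \<Longrightarrow> G s t = H s t" "finite S"
  shows "fdet S G = fdet S H"
proof -
  obtain \<sigma> where \<sigma>: "bij_betw \<sigma> {0..<card S} S"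
    and e: "\<And>G. fdet S G = (\<Sum>\<pi> | \<pi> permutes {0..<card S}.
          of_int (sign \<pi>) * (\<Prod>i = 0..<card S. G (\<sigma> i) (\<sigma> (\<pi> i))))"
    using fdet_expand[of S] \<open>finite S\<close> by blast
  have "\<sigma> i \<in> S" if "i \<in> {0..<card S}" for i using \<sigma> that by (auto simp: bij_betw_def)
  then show ?thesis unfolding e
    by (intro sum.cong prod.cong refl arg_cong2[where f="(*)"] assms)
       (simp_all add: permutes_in_image del: atLeastLessThan_iff)
qed

lemma fdet_eq_0_iff:
  assumes "finite S"
  shows "fdet S G = 0 \<longleftrightarrow> (\<exists>c. (\<exists>s\<in>S. c s \<noteq> 0) \<and> (\<forall>s\<in>S. (\<Sum>t\<in>S. G s t * c t) = 0))"
proof -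
  define n where "n = card S"
  define \<sigma> where "\<sigma> = (SOME h. bij_betw h {0..<n} S)"
  have \<sigma>: "bij_betw \<sigma> {0..<n} S"
    unfolding \<sigma>_def n_def using ex_bij_betw_nat_finite[OF assms] by (rule someI_ex)
  have img: "\<sigma> k \<in> S" if "k < n" for k using \<sigma> that by (auto simp: bij_betw_def)
  have surj: "\<exists>k<n. s = \<sigma> k" if "s \<in> S" for s
    using bij_betw_imp_surj_on[OF \<sigma>] that by force
  define A where "A = mat n n (\<lambda>(k, l). G (\<sigma> k) (\<sigma> l))"
  have A: "A \<in> carrier_mat n n" by (simp add: A_def)
  have row: "vec_index (A *\<^sub>v v) k = (\<Sum>l\<in>{0..<n}. G (\<sigma> k) (\<sigma> l) * vec_index v l)"
    if "k < n" "v \<in> carrier_vec n" for k v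
    using that by (simp add: A_def scalar_prod_def)
  have "fdet S G = Determinant.det A" by (simp add: fdet_def A_def n_def \<sigma>_def Let_def)
  also have "\<dots> = 0 \<longleftrightarrow> (\<exists>v. v \<in> carrier_vec n \<and> v \<noteq> 0\<^sub>v n \<and> A *\<^sub>v v = 0\<^sub>v n)"
    by (rule det_0_iff_vec_prod_zero_field[OF A])
  also have "\<dots> \<longleftrightarrow> (\<exists>c. (\<exists>s\<in>S. c s \<noteq> 0) \<and> (\<forall>s\<in>S. (\<Sum>t\<in>S. G s t * c t) = 0))"
  proof
    assume "\<exists>v. v \<in> carrier_vec n \<and> v \<noteq> 0\<^sub>v n \<and> A *\<^sub>v v = 0\<^sub>v n"
    then obtain v where v: "v \<in> carrier_vec n" "v \<noteq> 0\<^sub>v n" "A *\<^sub>v v = 0\<^sub>v n" by blast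
    define c where "c s = vec_index v (the_inv_into {0..<n} \<sigma> s)" for s
    have c: "c (\<sigma> l) = vec_index v l" if "l \<in> {0..<n}" for l
      using that \<sigma> unfolding c_def bij_betw_def by (simp add: the_inv_into_f_f)
    obtain l where l: "l < n" "vec_index v l \<noteq> 0" using v(1,2) by (metis carrier_vecD eq_vecI index_zero_vec)
    have "\<sigma> l \<in> S" "c (\<sigma> l) \<noteq> 0" using img l c by auto
    moreover have "(\<Sum>t\<in>S. G s t * c t) = 0" if "s \<in> S" for s
    proof -
      obtain k where k: "k < n" "s = \<sigma> k" using surj[OF \<open>s \<in> S\<close>] by blast
      have "(\<Sum>t\<in>S. G s t * c t) = (\<Sum>l\<in>{0..<n}. G (\<sigma> k) (\<sigma> l) * vec_index v l)"
        unfolding k(2) sum.reindex_bij_betw[OF \<sigma>, symmetric] by (intro sum.cong refl) (simp only: c)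
      also have "\<dots> = 0" using row[of k v] v k by simp
      finally show ?thesis .
    qed
    ultimately show "\<exists>c. (\<exists>s\<in>S. c s \<noteq> 0) \<and> (\<forall>s\<in>S. (\<Sum>t\<in>S. G s t * c t) = 0)" by blast
  next
    assume "\<exists>c. (\<exists>s\<in>S. c s \<noteq> 0) \<and> (\<forall>s\<in>S. (\<Sum>t\<in>S. G s t * c t) = 0)"
    then obtain c s where c: "s \<in> S" "c s \<noteq> 0" "\<forall>s\<in>S. (\<Sum>t\<in>S. G s t * c t) = 0" by blast
    define v where "v = vec n (\<lambda>l. c (\<sigma> l))"
    have v: "v \<in> carrier_vec n" by (simp add: v_def)
    obtain l where l: "l < n" "s = \<sigma> l" using surj c(1) by blast
    have "vec_index v l \<noteq> 0" using l c by (simp add: v_def)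
    then have "v \<noteq> 0\<^sub>v n" using l by auto
    moreover have "A *\<^sub>v v = 0\<^sub>v n"
    proof (rule eq_vecI)
      fix k assume "k < dim_vec (0\<^sub>v n)"
      then have k: "k < n" by simp
      have "vec_index (A *\<^sub>v v) k = (\<Sum>l\<in>{0..<n}. G (\<sigma> k) (\<sigma> l) * c (\<sigma> l))"
        using row[OF k v] by (simp add: v_def)
      also have "\<dots> = (\<Sum>t\<in>S. G (\<sigma> k) t * c t)" by (rule sum.reindex_bij_betw[OF \<sigma>])
      also have "\<dots> = 0" using c(3) img k by simp
      finally show "vec_index (A *\<^sub>v v) k = vec_index (0\<^sub>v n) k" using k by simp
    qed (use A in auto)
    ultimately show "\<exists>v. v \<in> carrier_vec n \<and> v \<noteq> 0\<^sub>v n \<and> A *\<^sub>v v = 0\<^sub>v n" using v by blast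
  qed
  finally show ?thesis .
qed

text \<open>A single expression whose nonvanishing means that the rows are independent, which avoids
  choosing a nonzero minor. It is polynomial in the entries of \<open>a\<close>.\<close>

definition gram_det :: "'s set \<Rightarrow> 'j set \<Rightarrow> ('s \<Rightarrow> 'j \<Rightarrow> real) \<Rightarrow> real" where
  "gram_det S J a = fdet S (\<lambda>s t. \<Sum>j\<in>J. a s j * a t j)"

text \<open>If the Gram matrix annihilates \<open>c\<close>, pairing with \<open>c\<close> gives the
  sum of the squared coordinates of the row combination with coefficients \<open>c\<close>; over the
  reals that combination vanishes.\<close>

lemma gram_det_nonzero_iff:
  assumes "finite S" "finite J"
  shows "gram_det S J a \<noteq> 0 \<longleftrightarrow> lin_indep S J a"
proof -
  have swap: "(\<Sum>t\<in>S. (\<Sum>j\<in>J. a s j * a t j) * c t) = (\<Sum>j\<in>J. a s j * (\<Sum>t\<in>S. c t * a t j))" for s c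
    unfolding sum_distrib_left sum_distrib_right
    by (subst sum.swap) (intro sum.cong refl, simp add: ac_simps)
  have "(\<forall>s\<in>S. (\<Sum>t\<in>S. (\<Sum>j\<in>J. a s j * a t j) * c t) = 0) \<longleftrightarrow> (\<forall>j\<in>J. (\<Sum>t\<in>S. c t * a t j) = 0)" for c
  proof
    assume "\<forall>s\<in>S. (\<Sum>t\<in>S. (\<Sum>j\<in>J. a s j * a t j) * c t) = 0"
    then have "0 = (\<Sum>s\<in>S. c s * (\<Sum>j\<in>J. a s j * (\<Sum>t\<in>S. c t * a t j)))" by (simp add: swap)
    also have "\<dots> = (\<Sum>j\<in>J. (\<Sum>t\<in>S. c t * a t j)\<^sup>2)"
      unfolding sum_distrib_left power2_eq_square
      by (subst sum.swap, intro sum.cong refl) (simp add: sum_distrib_right sum_distrib_left ac_simps)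
    finally show "\<forall>j\<in>J. (\<Sum>t\<in>S. c t * a t j) = 0"
      using sum_nonneg_eq_0_iff[OF assms(2), of "\<lambda>j. (\<Sum>t\<in>S. c t * a t j)\<^sup>2"] by simp
  qed (simp add: swap)
  then show ?thesis unfolding gram_det_def fdet_eq_0_iff[OF assms(1)] lin_indep_def by blast
qed

section \<open>Orthogonal projections, dual vectors and row bases\<close>

text \<open>Gram-Schmidt by induction: the target \<open>b\<close> and the new row are both reduced
  modulo the old rows, to \<open>y\<close> and \<open>z\<close>, and then the component of
  \<open>y\<close> along \<open>z\<close> is removed.\<close>

lemma orth_projection_exists:
  fixes a :: "'s \<Rightarrow> 'j \<Rightarrow> real"
  assumes "finite S" "finite J"
  shows "\<exists>c. \<forall>t\<in>S. (\<Sum>j\<in>J. (b j - (\<Sum>s\<in>S. c s * a s j)) * a t j) = 0"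
  using assms(1)
proof (induction S arbitrary: b rule: finite_induct)
  case (insert k S)
  obtain c where c: "\<forall>t\<in>S. (\<Sum>j\<in>J. (b j - (\<Sum>s\<in>S. c s * a s j)) * a t j) = 0"
    using insert.IH by blast
  obtain e where e: "\<forall>t\<in>S. (\<Sum>j\<in>J. (a k j - (\<Sum>s\<in>S. e s * a s j)) * a t j) = 0"
    using insert.IH by blast
  define z where "z j = a k j - (\<Sum>s\<in>S. e s * a s j)" for j
  define y where "y j = b j - (\<Sum>s\<in>S. c s * a s j)" for j
  define n where "n = (\<Sum>j\<in>J. z j * z j)"
  \<comment> \<open>If \<open>n = 0\<close>, division by zero gives \<open>\<alpha> = 0\<close>.
    This is harmless because \<open>z\<close> then vanishes on \<open>J\<close>.\<close>
  define \<alpha> where "\<alpha> = (\<Sum>j\<in>J. y j * z j) / n"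
  have n0: "z j = 0" if "n = 0" "j \<in> J" for j
    using that sum_nonneg_eq_0_iff[OF assms(2), of "\<lambda>j. z j * z j"] by (simp add: n_def)
  have \<alpha>: "(\<Sum>j\<in>J. (y j - \<alpha> * z j) * z j) = 0"
  proof -
    have "(\<Sum>j\<in>J. (y j - \<alpha> * z j) * z j) = (\<Sum>j\<in>J. y j * z j) - \<alpha> * n"
      by (simp add: n_def algebra_simps sum_subtractf sum_distrib_left)
    also have "\<dots> = 0" using n0 by (cases "n = 0") (auto simp: \<alpha>_def)
    finally show ?thesis .
  qed
  have S: "(\<Sum>j\<in>J. (y j - \<alpha> * z j) * a t j) = 0" if "t \<in> S" for t
  proof -
    have "(\<Sum>j\<in>J. (y j - \<alpha> * z j) * a t j) = (\<Sum>j\<in>J. y j * a t j) - \<alpha> * (\<Sum>j\<in>J. z j * a t j)"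
      by (simp add: algebra_simps sum_subtractf sum_distrib_left)
    then show ?thesis using c e that by (simp add: y_def z_def)
  qed
  have k: "(\<Sum>j\<in>J. (y j - \<alpha> * z j) * a k j) = 0"
  proof -
    have "(\<Sum>j\<in>J. (y j - \<alpha> * z j) * a k j) = 
        (\<Sum>j\<in>J. (y j - \<alpha> * z j) * z j + (\<Sum>s\<in>S. e s * ((y j - \<alpha> * z j) * a s j)))"
    proof (rule sum.cong[OF refl])
      fix j
      have "x * (z j + (\<Sum>s\<in>S. e s * a s j)) = x * z j + (\<Sum>s\<in>S. e s * (x * a s j))" for x
        by (simp only: distrib_left sum_distrib_left mult.left_commute)
      from this[of "y j - \<alpha> * z j"] show "(y j - \<alpha> * z j) * a k j = (y j - \<alpha> * z j) * z j + (\<Sum>s\<in>S. e s * ((y j - \<alpha> * z j) * a s j))"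
        by (simp add: z_def)
    qed
    also have "\<dots> = (\<Sum>j\<in>J. (y j - \<alpha> * z j) * z j) + (\<Sum>s\<in>S. e s * (\<Sum>j\<in>J. (y j - \<alpha> * z j) * a s j))"
      unfolding sum.distrib by (subst sum.swap[of _ S J]) (simp add: sum_distrib_left)
    finally show ?thesis using \<alpha> S by simp
  qed
  define c' where "c' s = (if s = k then \<alpha> else c s - \<alpha> * e s)" for s
  have "b j - (\<Sum>s\<in>insert k S. c' s * a s j) = y j - \<alpha> * z j" for j
  proof -
    have "(\<Sum>s\<in>S. c' s * a s j) = (\<Sum>s\<in>S. c s * a s j) - \<alpha> * (\<Sum>s\<in>S. e s * a s j)"
      unfolding sum_distrib_left sum_subtractf[symmetric]
      using insert.hyps by (intro sum.cong refl) (auto simp: c'_def algebra_simps)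
    then show ?thesis using insert.hyps by (simp add: y_def z_def c'_def algebra_simps)
  qed
  then show ?case using S k by (intro exI[of _ c']) auto
qed simp

text \<open>The residual \<open>w\<close> of row \<open>s0\<close> after projection onto the other
  rows is orthogonal to them. Its product \<open>n\<close> with row \<open>s0\<close> is its squared
  norm, nonzero by independence; dividing by \<open>n\<close> normalises it.\<close>

lemma dual_vector_exists:
  fixes a :: "'s \<Rightarrow> 'j \<Rightarrow> real"
  assumes ind: "lin_indep S J a" and fin: "finite S" "finite J" and s0: "s0 \<in> S"
  shows "\<exists>w. \<forall>s\<in>S. (\<Sum>j\<in>J. a s j * w j) = of_bool (s = s0)"
proof -
  obtain c where c: "\<forall>t\<in>S-{s0}. (\<Sum>j\<in>J. (a s0 j - (\<Sum>s\<in>S-{s0}. c s * a s j)) * a t j) = 0"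
    using orth_projection_exists[of "S - {s0}" J] fin by blast
  define w where "w j = a s0 j - (\<Sum>s\<in>S-{s0}. c s * a s j)" for j
  have w: "(\<Sum>j\<in>J. a s j * w j) = 0" if "s \<in> S - {s0}" for s
    using c that by (simp add: w_def mult.commute)
  define n where "n = (\<Sum>j\<in>J. a s0 j * w j)"
  have "n \<noteq> 0"
  proof
    assume "n = 0"
    have "(\<Sum>j\<in>J. w j * w j) = (\<Sum>j\<in>J. a s0 j * w j - (\<Sum>s\<in>S-{s0}. c s * (a s j * w j)))"
    proof (rule sum.cong[OF refl])
      fix j
      have "(a s0 j - (\<Sum>s\<in>S-{s0}. c s * a s j)) * x = a s0 j * x - (\<Sum>s\<in>S-{s0}. c s * (a s j * x))" for x
        by (simp add: left_diff_distrib sum_distrib_right mult.assoc)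
      from this[of "w j"] show "w j * w j = a s0 j * w j - (\<Sum>s\<in>S-{s0}. c s * (a s j * w j))"
        by (simp add: w_def)
    qed
    also have "\<dots> = n - (\<Sum>s\<in>S-{s0}. c s * (\<Sum>j\<in>J. a s j * w j))"
      unfolding sum_subtractf n_def by (subst sum.swap[of _ _ J]) (simp add: sum_distrib_left)
    also have "\<dots> = 0" using w \<open>n = 0\<close> by simp
    finally have "w j = 0" if "j \<in> J" for j
      using sum_nonneg_eq_0_iff[OF fin(2), of "\<lambda>j. w j * w j"] that by simp
    then have z: "(\<Sum>s\<in>S. (if s = s0 then 1 else - c s) * a s j) = 0" if "j \<in> J" for j
      using that fin s0 by (subst sum.remove[of _ s0]) (auto simp: w_def sum_negf)
    show False using lin_indepD[OF ind z s0] by simp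
  qed
  then have "\<forall>s\<in>S. (\<Sum>j\<in>J. a s j * (w j / n)) = of_bool (s = s0)"
    using w by (auto simp: n_def sum_divide_distrib[symmetric])
  then show ?thesis by (intro exI[of _ "\<lambda>j. w j / n"])
qed

lemma maximal_lin_indep_subset:
  assumes "finite S"
  obtains B where "B \<subseteq> S" "lin_indep B J a" "\<And>s. s \<in> S \<Longrightarrow> s \<notin> B \<Longrightarrow> \<not> lin_indep (insert s B) J a"
proof -
  let ?F = "{B. B \<subseteq> S \<and> lin_indep B J a}"
  have "{} \<in> ?F" by (simp add: lin_indep_def)
  then have "?F \<noteq> {}" by blast
  moreover have "finite ?F" using assms by simp
  ultimately have "\<exists>B\<in>?F. \<forall>C\<in>?F. B \<subseteq> C \<longrightarrow> B = C"
    by (intro finite_has_maximal)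
  then obtain B where B: "B \<in> ?F" "\<And>C. C \<in> ?F \<Longrightarrow> B \<subseteq> C \<Longrightarrow> B = C" by (elim bexE) simp
  show ?thesis
  proof (rule that[of B])
    show "\<not> lin_indep (insert s B) J a" if "s \<in> S" "s \<notin> B" for s
      using that B(1) B(2)[of "insert s B"] by auto
  qed (use B in auto)
qed

text \<open>The vector \<open>q\<close> annihilates the rows of \<open>B\<close> but not that of
  \<open>e\<close>, which therefore lies outside their span.\<close>

lemma lin_indep_insertI:
  assumes B: "lin_indep B J a" and fin: "finite B"
    and q: "\<And>s. s \<in> B \<Longrightarrow> (\<Sum>j\<in>J. a s j * q j) = 0" "(\<Sum>j\<in>J. a e j * q j) \<noteq> 0"
  shows "lin_indep (insert e B) J a"
proof (rule lin_indepI)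
  fix c s assume c: "\<And>j. j \<in> J \<Longrightarrow> (\<Sum>s\<in>insert e B. c s * a s j) = 0" and s: "s \<in> insert e B"
  have e: "e \<notin> B" using q by blast
  have "0 = (\<Sum>j\<in>J. (\<Sum>s\<in>insert e B. c s * a s j) * q j)" using c by simp
  also have "\<dots> = (\<Sum>s\<in>insert e B. c s * (\<Sum>j\<in>J. a s j * q j))"
    unfolding sum_distrib_left sum_distrib_right by (subst sum.swap) (simp add: ac_simps)
  also have "\<dots> = c e * (\<Sum>j\<in>J. a e j * q j)" using fin e q(1) by simp
  finally have ce: "c e = 0" using q(2) by simp
  then have "\<And>j. j \<in> J \<Longrightarrow> (\<Sum>s\<in>B. c s * a s j) = 0" using c fin e by simp
  then show "c s = 0" using lin_indepD[OF B, of c] s ce by blast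
qed

text \<open>Contrapositive of \<open>lin_indep_insertI\<close>. The two cases of \<open>dep\<close>
  together say that the row of \<open>e\<close> lies in the span of the rows of
  \<open>B\<close>.\<close>

lemma orth_of_dependent_insert:
  assumes B: "lin_indep B J a" and fin: "finite B" "finite J"
    and dep: "e \<in> B \<or> \<not> lin_indep (insert e B) J a"
    and q: "\<And>s. s \<in> B \<Longrightarrow> (\<Sum>j\<in>J. a s j * q j) = 0"
  shows "(\<Sum>j\<in>J. a e j * q j) = 0"
proof (rule ccontr)
  assume n: "(\<Sum>j\<in>J. a e j * q j) \<noteq> 0"
  then have "lin_indep (insert e B) J a" using q by (intro lin_indep_insertI[OF B fin(1), of q])
  then show False using dep n q by blast
qed

section \<open>Polynomial functions of placements\<close>

definition mono_eval :: "('i \<Rightarrow> real) \<Rightarrow> ('i \<Rightarrow>\<^sub>0 nat) \<Rightarrow> real" where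
  "mono_eval x a = (\<Prod>i\<in>Poly_Mapping.keys a. x i ^ Poly_Mapping.lookup a i)"

lemma mono_eval_superset:
  assumes "finite K" "Poly_Mapping.keys a \<subseteq> K"
  shows "mono_eval x a = (\<Prod>i\<in>K. x i ^ Poly_Mapping.lookup a i)"
  unfolding mono_eval_def using assms
  by (intro prod.mono_neutral_left) (auto simp: in_keys_iff)

lemma mono_eval_add: "mono_eval x (a + b) = mono_eval x a * mono_eval x b"
proof -
  let ?K = "Poly_Mapping.keys a \<union> Poly_Mapping.keys b"
  have "Poly_Mapping.keys (a + b) \<subseteq> ?K" by (rule Poly_Mapping.keys_add)
  then show ?thesis
    by (simp add: mono_eval_superset[of ?K] lookup_add power_add prod.distrib)
qed

lemma eval_rat_mpoly_mono:
  "eval_rat_mpoly x f = (\<Sum>a\<in>Poly_Mapping.keys f. of_rat (Poly_Mapping.lookup f a) * mono_eval x a)"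
  unfolding eval_rat_mpoly_def mono_eval_def ..

lemma eval_rat_mpoly_add: "eval_rat_mpoly x (f + g) = eval_rat_mpoly x f + eval_rat_mpoly x g"
  unfolding eval_rat_mpoly_mono
  by (rule setsum_keys_plus_distrib) (simp_all add: of_rat_add distrib_right)

lemma eval_rat_mpoly_0 [simp]: "eval_rat_mpoly x 0 = 0"
  by (simp add: eval_rat_mpoly_mono)

lemma eval_rat_mpoly_sum: "eval_rat_mpoly x (\<Sum>i\<in>A. f i) = (\<Sum>i\<in>A. eval_rat_mpoly x (f i))"
  by (induction A rule: infinite_finite_induct) (simp_all add: eval_rat_mpoly_add)

lemma eval_rat_mpoly_single:
  "eval_rat_mpoly x (Poly_Mapping.single a c) = of_rat c * mono_eval x a"
  by (simp add: eval_rat_mpoly_mono)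

lemma poly_mapping_sum_singles:
  "f = (\<Sum>a\<in>Poly_Mapping.keys f. Poly_Mapping.single a (Poly_Mapping.lookup f a))"
  by (rule poly_mapping_eqI)
     (auto simp: lookup_sum lookup_single when_def in_keys_iff)

lemma eval_rat_mpoly_mult: "eval_rat_mpoly x (f * g) = eval_rat_mpoly x f * eval_rat_mpoly x g"
proof -
  have "f * g = (\<Sum>a\<in>Poly_Mapping.keys f. \<Sum>b\<in>Poly_Mapping.keys g.
      Poly_Mapping.single (a + b) (Poly_Mapping.lookup f a * Poly_Mapping.lookup g b))"
    by (subst (1) poly_mapping_sum_singles[of f], subst (1) poly_mapping_sum_singles[of g])
       (simp add: sum_product mult_single)
  then show ?thesis
    by (simp add: eval_rat_mpoly_sum eval_rat_mpoly_single mono_eval_add of_rat_mult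
        eval_rat_mpoly_mono[of x f] eval_rat_mpoly_mono[of x g] sum_product ac_simps)
qed

text \<open>The coefficients are rational, as genericity requires. The closure rules below spare
  writing such polynomials down.\<close>

definition config_poly :: "'v set \<Rightarrow> (('v \<Rightarrow> real ^ 'd) \<Rightarrow> real) \<Rightarrow> bool" where
  "config_poly V h \<longleftrightarrow> (\<exists>f. (\<forall>a\<in>Poly_Mapping.keys f. Poly_Mapping.keys a \<subseteq> V \<times> UNIV) \<and>
     (\<forall>p. h p = eval_rat_mpoly (\<lambda>(v, c). p v $ c) f))"

lemma config_poly_of_rat: "config_poly V (\<lambda>p. of_rat r)"
  unfolding config_poly_def
  by (intro exI[of _ "Poly_Mapping.single 0 r"]) (simp add: eval_rat_mpoly_single mono_eval_def)

lemma config_poly_0 [simp]: "config_poly V (\<lambda>p. 0)"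
  using config_poly_of_rat[of V 0] by simp

lemma config_poly_1 [simp]: "config_poly V (\<lambda>p. 1)"
  using config_poly_of_rat[of V 1] by simp

lemma config_poly_of_int [simp]: "config_poly V (\<lambda>p. of_int k)"
  using config_poly_of_rat[of V "of_int k"] by simp

lemma config_poly_of_bool [simp]: "config_poly V (\<lambda>p. of_bool b)"
  by (cases b) simp_all

lemma config_poly_coord: "v \<in> V \<Longrightarrow> config_poly V (\<lambda>p. p v $ c)"
  unfolding config_poly_def
  by (intro exI[of _ "Poly_Mapping.single (Poly_Mapping.single (v, c) 1) 1"])
     (simp add: eval_rat_mpoly_single mono_eval_def)

lemma config_poly_add:
  "config_poly V h \<Longrightarrow> config_poly V k \<Longrightarrow> config_poly V (\<lambda>p. h p + k p)"
  unfolding config_poly_def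
  by (elim exE, rename_tac f g, rule_tac x="f + g" in exI)
     (use Poly_Mapping.keys_add in \<open>fastforce simp: eval_rat_mpoly_add\<close>)

lemma keys_mult_subset:
  assumes "\<forall>a\<in>Poly_Mapping.keys f. Poly_Mapping.keys a \<subseteq> I"
    "\<forall>a\<in>Poly_Mapping.keys g. Poly_Mapping.keys a \<subseteq> I" "a \<in> Poly_Mapping.keys (f * g)"
  shows "Poly_Mapping.keys (a :: 'i \<Rightarrow>\<^sub>0 nat) \<subseteq> I"
proof -
  obtain b c where "a = b + c" "b \<in> Poly_Mapping.keys f" "c \<in> Poly_Mapping.keys g"
    using keys_mult[of f g] assms(3) by blast
  then show ?thesis using Poly_Mapping.keys_add[of b c] assms(1,2) by blast
qed

lemma config_poly_mult:
  "config_poly V h \<Longrightarrow> config_poly V k \<Longrightarrow> config_poly V (\<lambda>p. h p * k p)"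
  unfolding config_poly_def
  by (elim exE, rename_tac f g, rule_tac x="f * g" in exI)
     (auto simp: eval_rat_mpoly_mult dest: keys_mult_subset[rotated 2])

lemma config_poly_minus: "config_poly V h \<Longrightarrow> config_poly V (\<lambda>p. - h p)"
  using config_poly_mult[OF config_poly_of_int[of V "-1"], of h] by simp

lemma config_poly_diff:
  "config_poly V h \<Longrightarrow> config_poly V k \<Longrightarrow> config_poly V (\<lambda>p. h p - k p)"
  using config_poly_add[OF _ config_poly_minus] by fastforce

lemma config_poly_sum:
  "(\<And>i. i \<in> A \<Longrightarrow> config_poly V (h i)) \<Longrightarrow> config_poly V (\<lambda>p. \<Sum>i\<in>A. h i p)"
  by (induction A rule: infinite_finite_induct) (simp_all add: config_poly_add)

lemma config_poly_prod:
  "(\<And>i. i \<in> A \<Longrightarrow> config_poly V (h i)) \<Longrightarrow> config_poly V (\<lambda>p. \<Prod>i\<in>A. h i p)"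
  by (induction A rule: infinite_finite_induct) (simp_all add: config_poly_mult)

lemma config_poly_gram_det:
  assumes fin: "finite S" and h: "\<And>s j. s \<in> S \<Longrightarrow> j \<in> J \<Longrightarrow> config_poly V (\<lambda>p. a p s j)"
  shows "config_poly V (\<lambda>p. gram_det S J (a p))"
proof -
  obtain \<sigma> where \<sigma>: "bij_betw \<sigma> {0..<card S} S"
    and e: "\<And>G. fdet S G = (\<Sum>\<pi> | \<pi> permutes {0..<card S}.
          of_int (sign \<pi>) * (\<Prod>i = 0..<card S. G (\<sigma> i) (\<sigma> (\<pi> i))))"
    using fdet_expand[of S] fin by blast
  have *: "\<sigma> i \<in> S" if "i \<in> {0..<card S}" for i
    using bij_betwE[OF \<sigma>] that by blast
  show ?thesis unfolding gram_det_def e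
    by (intro config_poly_sum config_poly_mult config_poly_prod config_poly_of_int h *)
       (simp_all add: permutes_in_image del: atLeastLessThan_iff)
qed

text \<open>Algebraic independence forces the polynomial itself to be zero, not just its value at
  \<open>p\<close>.\<close>

lemma generic_config_poly_zero:
  assumes "generic V p" "config_poly V h" "h p = 0"
  shows "h q = 0"
proof -
  obtain f where "\<forall>a\<in>Poly_Mapping.keys f. Poly_Mapping.keys a \<subseteq> V \<times> UNIV"
    and f: "\<And>p. h p = eval_rat_mpoly (\<lambda>(v, c). p v $ c) f"
    using assms(2) unfolding config_poly_def by blast
  then have "f = 0"
    using assms(1,3) unfolding generic_def alg_independent_rat_def by simp
  then show ?thesis using f[of q] by simp
qed

text \<open>Transfer principle: independence witnessed at any placement \<open>q\<close>, however
  special, passes to every generic \<open>p\<close>, because the Gram determinant is a polynomial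
  that is nonzero somewhere.\<close>

lemma generic_lin_indep:
  assumes "generic V p" "finite S" "finite J"
    and "\<And>s j. s \<in> S \<Longrightarrow> j \<in> J \<Longrightarrow> config_poly V (\<lambda>p. a p s j)"
    and "lin_indep S J (a q)"
  shows "lin_indep S J (a p)"
proof -
  have "gram_det S J (a q) = 0" if "gram_det S J (a p) = 0"
    by (rule generic_config_poly_zero[OF assms(1) config_poly_gram_det[OF assms(2,4)] that])
  then show ?thesis using assms(5) gram_det_nonzero_iff[OF assms(2,3)] by blast
qed

lemma continuous_on_gram_det:
  assumes fin: "finite S" and h: "\<And>s j. s \<in> S \<Longrightarrow> j \<in> J \<Longrightarrow> continuous_on U (\<lambda>t. a t s j)"
  shows "continuous_on U (\<lambda>t. gram_det S J (a t))"
proof -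
  obtain \<sigma> where \<sigma>: "bij_betw \<sigma> {0..<card S} S"
    and e: "\<And>G. fdet S G = (\<Sum>\<pi> | \<pi> permutes {0..<card S}.
          of_int (sign \<pi>) * (\<Prod>i = 0..<card S. G (\<sigma> i) (\<sigma> (\<pi> i))))"
    using fdet_expand[of S] fin by blast
  have *: "\<sigma> i \<in> S" if "i \<in> {0..<card S}" for i
    using bij_betwE[OF \<sigma>] that by blast
  show ?thesis unfolding gram_det_def e
    by (intro continuous_intros h *)
       (simp_all add: permutes_in_image del: atLeastLessThan_iff)
qed

section \<open>Existence of generic placements\<close>

text \<open>Grouping monomials by the exponent of the new variable turns \<open>f\<close> into a
  polynomial in \<open>t\<close> whose coefficients are the values at \<open>x\<close> of
  polynomials \<open>g n\<close> in the old variables. Some \<open>g n\<close> is nonzero, and then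
  so is its value.\<close>

lemma finite_roots_fun_upd:
  fixes x :: "'i \<Rightarrow> real"
  assumes ind: "alg_independent_rat I x" and i: "i \<notin> I"
    and keys: "\<forall>a\<in>Poly_Mapping.keys f. Poly_Mapping.keys a \<subseteq> insert i I" and "f \<noteq> 0"
  shows "finite {t. eval_rat_mpoly (x(i := t)) f = 0}"
proof -
  let ?K = "Poly_Mapping.keys f"
  define r :: "('i \<Rightarrow>\<^sub>0 nat) \<Rightarrow> ('i \<Rightarrow>\<^sub>0 nat)" where "r a = Poly_Mapping.update i 0 a" for a
  have lr: "Poly_Mapping.lookup (r a) j = (if j = i then 0 else Poly_Mapping.lookup a j)" for a j
    by (simp add: r_def lookup_update)
  have kr: "Poly_Mapping.keys (r a) = Poly_Mapping.keys a - {i}" for a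
    by (auto simp: in_keys_iff lr split: if_splits)
  define g where "g n = (\<Sum>a | a \<in> ?K \<and> Poly_Mapping.lookup a i = n.
      Poly_Mapping.single (r a) (Poly_Mapping.lookup f a))" for n
  define N where "N = (\<Sum>a\<in>?K. Poly_Mapping.lookup a i)"
  have N: "Poly_Mapping.lookup a i \<le> N" if "a \<in> ?K" for a
    unfolding N_def using that by (intro member_le_sum) auto
  have mono: "mono_eval (x(i := t)) a = mono_eval x (r a) * t ^ Poly_Mapping.lookup a i" for t a
  proof -
    have "mono_eval (x(i := t)) a = (\<Prod>j\<in>insert i (Poly_Mapping.keys a). (x(i := t)) j ^ Poly_Mapping.lookup a j)"
      by (rule mono_eval_superset) auto
    also have "\<dots> = t ^ Poly_Mapping.lookup a i * (\<Prod>j\<in>Poly_Mapping.keys a - {i}. (x(i := t)) j ^ Poly_Mapping.lookup a j)"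
      by (subst prod.insert_remove) auto
    also have "(\<Prod>j\<in>Poly_Mapping.keys a - {i}. (x(i := t)) j ^ Poly_Mapping.lookup a j) = mono_eval x (r a)"
      unfolding mono_eval_def kr by (intro prod.cong refl) (auto simp: lr)
    finally show ?thesis by (simp only: mult.commute)
  qed
  have g: "eval_rat_mpoly x (g n) =
      (\<Sum>a | a \<in> ?K \<and> Poly_Mapping.lookup a i = n. of_rat (Poly_Mapping.lookup f a) * mono_eval x (r a))" for n
    by (simp add: g_def eval_rat_mpoly_sum eval_rat_mpoly_single)
  have ev: "eval_rat_mpoly (x(i := t)) f = (\<Sum>n\<le>N. eval_rat_mpoly x (g n) * t ^ n)" for t
  proof -
    have "eval_rat_mpoly (x(i := t)) f =
        (\<Sum>a\<in>?K. of_rat (Poly_Mapping.lookup f a) * mono_eval x (r a) * t ^ Poly_Mapping.lookup a i)"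
      by (simp add: eval_rat_mpoly_mono mono mult.assoc)
    also have "\<dots> = (\<Sum>n\<le>N. \<Sum>a | a \<in> ?K \<and> Poly_Mapping.lookup a i = n.
        of_rat (Poly_Mapping.lookup f a) * mono_eval x (r a) * t ^ Poly_Mapping.lookup a i)"
      by (rule sum.group[symmetric]) (use N in auto)
    also have "\<dots> = (\<Sum>n\<le>N. eval_rat_mpoly x (g n) * t ^ n)"
      unfolding g sum_distrib_right by (intro sum.cong refl) auto
    finally show ?thesis .
  qed
  obtain a0 where a0: "a0 \<in> ?K" using \<open>f \<noteq> 0\<close> by fastforce
  define n0 where "n0 = Poly_Mapping.lookup a0 i"
  \<comment> \<open>This excludes cancellation in \<open>g n0\<close>: a monomial is determined by
    its exponent at \<open>i\<close> and by what remains after deleting that exponent.\<close>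
  have inj: "a = a0" if "Poly_Mapping.lookup a i = n0" "r a = r a0" for a
  proof (rule poly_mapping_eqI)
    fix j show "Poly_Mapping.lookup a j = Poly_Mapping.lookup a0 j"
      using that lr[of a j] lr[of a0 j] by (cases "j = i") (auto simp: n0_def)
  qed
  have "Poly_Mapping.lookup (g n0) (r a0) =
      (\<Sum>a | a \<in> ?K \<and> Poly_Mapping.lookup a i = n0. if a = a0 then Poly_Mapping.lookup f a else 0)"
    unfolding g_def lookup_sum
    by (intro sum.cong refl) (use inj in \<open>auto simp: lookup_single when_def\<close>)
  also have "\<dots> = Poly_Mapping.lookup f a0" using a0 by (simp add: n0_def)
  finally have "g n0 \<noteq> 0" using a0 by (auto simp: in_keys_iff)
  moreover have "\<forall>b\<in>Poly_Mapping.keys (g n0). Poly_Mapping.keys b \<subseteq> I"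
  proof
    fix b assume "b \<in> Poly_Mapping.keys (g n0)"
    then obtain a where "a \<in> ?K" "b = r a"
      unfolding g_def using keys_sum[of "\<lambda>a. Poly_Mapping.single (r a) (Poly_Mapping.lookup f a)"]
      by (fastforce split: if_splits)
    then show "Poly_Mapping.keys b \<subseteq> I" using keys i by (auto simp: kr)
  qed
  ultimately have "eval_rat_mpoly x (g n0) \<noteq> 0"
    using ind unfolding alg_independent_rat_def by blast
  moreover have "n0 \<le> N" using N a0 by (simp add: n0_def)
  ultimately show ?thesis unfolding ev by (subst polyfun_finite_roots) blast
qed

text \<open>A monomial is encoded by its exponents on the finite set \<open>I\<close>, a polynomial
  by the finite graph of its coefficients on its support.\<close>

lemma countable_mpolys:
  assumes "finite I"
  shows "countable {f :: ('i \<Rightarrow>\<^sub>0 nat) \<Rightarrow>\<^sub>0 rat. \<forall>a\<in>Poly_Mapping.keys f. Poly_Mapping.keys a \<subseteq> I}"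
proof -
  let ?M = "{a :: 'i \<Rightarrow>\<^sub>0 nat. Poly_Mapping.keys a \<subseteq> I}"
  have "inj_on (\<lambda>a. restrict (Poly_Mapping.lookup a) I) ?M"
  proof (rule inj_onI, rule poly_mapping_eqI)
    fix a b j assume ab: "a \<in> ?M" "b \<in> ?M"
      "restrict (Poly_Mapping.lookup a) I = restrict (Poly_Mapping.lookup b) I"
    show "Poly_Mapping.lookup a j = Poly_Mapping.lookup b j"
    proof (cases "j \<in> I")
      case True
      then show ?thesis using fun_cong[OF ab(3), of j] by simp
    next
      case False
      then have "j \<notin> Poly_Mapping.keys a" "j \<notin> Poly_Mapping.keys b" using ab by auto
      then show ?thesis by (simp add: in_keys_iff)
    qed
  qed
  moreover have "countable ((\<lambda>a. restrict (Poly_Mapping.lookup a) I) ` ?M)"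
    by (rule countable_subset[of _ "PiE I (\<lambda>_. UNIV)"]) (use assms in \<open>auto intro!: countable_PiE\<close>)
  ultimately have M: "countable ?M" by (rule countable_image_inj_on[rotated])
  let ?P = "{f :: ('i \<Rightarrow>\<^sub>0 nat) \<Rightarrow>\<^sub>0 rat. \<forall>a\<in>Poly_Mapping.keys f. Poly_Mapping.keys a \<subseteq> I}"
  let ?g = "\<lambda>f :: ('i \<Rightarrow>\<^sub>0 nat) \<Rightarrow>\<^sub>0 rat. (\<lambda>a. (a, Poly_Mapping.lookup f a)) ` Poly_Mapping.keys f"
  have "inj_on ?g ?P"
  proof (rule inj_onI, rule poly_mapping_eqI)
    fix f h a assume "?g f = ?g h"
    then have "(a, b) \<in> ?g f \<longleftrightarrow> (a, b) \<in> ?g h" for b by simp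
    then have *: "a \<in> Poly_Mapping.keys f \<and> b = Poly_Mapping.lookup f a \<longleftrightarrow>
        a \<in> Poly_Mapping.keys h \<and> b = Poly_Mapping.lookup h a" for b
      by (simp only: image_iff prod.inject) blast
    show "Poly_Mapping.lookup f a = Poly_Mapping.lookup h a"
      using *[of "Poly_Mapping.lookup f a"] *[of "Poly_Mapping.lookup h a"]
      by (auto simp: in_keys_iff)
  qed
  moreover have "countable (?g ` ?P)"
    by (rule countable_subset[OF _ countable_Collect_finite_subset[of "?M \<times> UNIV"]])
       (use M in auto)
  ultimately show ?thesis by (rule countable_image_inj_on[rotated])
qed

text \<open>Variables are added one at a time: countably many nonzero polynomials exclude finitely
  many values each, and the reals are uncountable.\<close>

lemma alg_independent_rat_exists:
  assumes "finite I"
  shows "\<exists>x. alg_independent_rat I (x :: 'i \<Rightarrow> real)"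
  using assms
proof (induction I rule: finite_induct)
  case empty
  have "f = 0" if "\<forall>a\<in>Poly_Mapping.keys f. Poly_Mapping.keys a \<subseteq> {}" "eval_rat_mpoly x f = 0"
    for x :: "'i \<Rightarrow> real" and f
  proof -
    have k: "Poly_Mapping.keys f \<subseteq> {0}" using that(1) by auto
    have "eval_rat_mpoly x f = (\<Sum>a\<in>{0}. of_rat (Poly_Mapping.lookup f a) * mono_eval x a)"
      unfolding eval_rat_mpoly_mono using k by (intro sum.mono_neutral_left) (auto simp: in_keys_iff)
    then have "0 \<notin> Poly_Mapping.keys f" using that(2) by (simp add: mono_eval_def in_keys_iff)
    then have "Poly_Mapping.keys f = {}" using k by blast
    then show ?thesis by simp
  qed
  then show ?case unfolding alg_independent_rat_def by blast
next
  case (insert i I)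
  then obtain x :: "'i \<Rightarrow> real" where x: "alg_independent_rat I x" by blast
  let ?P = "{f :: ('i \<Rightarrow>\<^sub>0 nat) \<Rightarrow>\<^sub>0 rat. \<forall>a\<in>Poly_Mapping.keys f. Poly_Mapping.keys a \<subseteq> insert i I} - {0}"
  let ?B = "\<Union>f\<in>?P. {t. eval_rat_mpoly (x(i := t)) f = 0}"
  have "countable ?P"
    by (rule countable_subset[OF _ countable_mpolys[of "insert i I"]]) (use insert.hyps in auto)
  moreover have "countable {t. eval_rat_mpoly (x(i := t)) f = 0}" if "f \<in> ?P" for f
    using finite_roots_fun_upd[OF x insert.hyps(2), of f] that by (auto intro: countable_finite)
  ultimately have "countable ?B" by (rule countable_UN)
  then have "?B \<noteq> UNIV" using uncountable_UNIV_real by auto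
  then obtain t where "t \<notin> ?B" by blast
  then have "alg_independent_rat (insert i I) (x(i := t))"
    unfolding alg_independent_rat_def by auto
  then show ?case by blast
qed

lemma generic_exists:
  assumes "finite V"
  obtains p :: "'v \<Rightarrow> real ^ 'd" where "generic V p"
proof -
  obtain x :: "'v \<times> 'd \<Rightarrow> real" where "alg_independent_rat (V \<times> UNIV) x"
    using alg_independent_rat_exists[of "V \<times> (UNIV :: 'd set)"] assms by auto
  moreover have "(\<lambda>(v, c). (\<chi> c. x (v, c)) $ c) = x" by auto
  ultimately have "generic V (\<lambda>v. \<chi> c. x (v, c))" by (simp add: generic_def)
  then show ?thesis by (rule that)
qed

section \<open>Rigidity matrices\<close>

text \<open>A row of the rigidity matrix. Ordered pairs avoid the choice of an orientation; the two
  orders of an edge give the same row.\<close>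

definition edge_row :: "('v \<Rightarrow> real ^ 'd) \<Rightarrow> 'v \<times> 'v \<Rightarrow> 'v \<times> 'd \<Rightarrow> real" where
  "edge_row p = (\<lambda>(u, v) (w, c). (of_bool (w = u) - of_bool (w = v)) * (p u $ c - p v $ c))"

lemma edge_pairs_subset:
  assumes "\<And>e. e \<in> E \<Longrightarrow> e \<subseteq> V"
  shows "{(u, v). {u, v} \<in> E} \<subseteq> V \<times> V"
proof
  fix x assume "x \<in> {(u, v). {u, v} \<in> E}"
  then obtain u v where "x = (u, v)" "{u, v} \<in> E" by blast
  then show "x \<in> V \<times> V" using assms[of "{u, v}"] by simp
qed

lemma sum_coords:
  fixes x y :: "'v \<Rightarrow> real ^ 'd"
  shows "(\<Sum>(w, c)\<in>V \<times> UNIV. x w $ c * y w $ c) = (\<Sum>w\<in>V. x w \<bullet> y w)"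
  by (simp add: sum.cartesian_product[symmetric] inner_vec_def)

lemma edge_row_apply:
  fixes p q :: "'v \<Rightarrow> real ^ 'd"
  assumes "finite V" "u \<in> V" "v \<in> V"
  shows "(\<Sum>j\<in>V \<times> UNIV. edge_row p (u, v) j * (case j of (w, c) \<Rightarrow> q w $ c)) = (p u - p v) \<bullet> (q u - q v)"
proof -
  let ?k = "\<lambda>w. of_bool (w = u) - of_bool (w = v) :: real"
  have "(\<Sum>j\<in>V \<times> UNIV. edge_row p (u, v) j * (case j of (w, c) \<Rightarrow> q w $ c)) =
      (\<Sum>(w, c)\<in>V \<times> UNIV. (?k w *\<^sub>R (p u - p v)) $ c * q w $ c)"
    by (intro sum.cong) (auto simp: edge_row_def)
  also have "\<dots> = (\<Sum>w\<in>V. (?k w *\<^sub>R (p u - p v)) \<bullet> q w)" by (rule sum_coords)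
  also have "\<dots> = (\<Sum>w\<in>V. (if w = u then (p u - p v) \<bullet> q w else 0)) - (\<Sum>w\<in>V. (if w = v then (p u - p v) \<bullet> q w else 0))"
    unfolding sum_subtractf[symmetric] by (intro sum.cong) (auto simp: algebra_simps)
  also have "\<dots> = (p u - p v) \<bullet> (q u - q v)" using assms by (simp add: inner_diff_right)
  finally show ?thesis .
qed

lemma sum_edge_row_edge_row:
  fixes p :: "'v \<Rightarrow> real ^ 'd"
  assumes "finite V" "u \<in> V" "v \<in> V"
  shows "(\<Sum>j\<in>V \<times> UNIV. edge_row p (u, v) j * edge_row p (u', v') j) =
    ((of_bool (u = u') - of_bool (u = v')) - (of_bool (v = u') - of_bool (v = v'))) *
    ((p u - p v) \<bullet> (p u' - p v'))"
proof -
  let ?q = "\<lambda>w. (of_bool (w = u') - of_bool (w = v') :: real) *\<^sub>R (p u' - p v')"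
  have "edge_row p (u', v') j = (case j of (w, c) \<Rightarrow> ?q w $ c)" for j
    by (cases j) (simp add: edge_row_def)
  then have "(\<Sum>j\<in>V \<times> UNIV. edge_row p (u, v) j * edge_row p (u', v') j) = (p u - p v) \<bullet> (?q u - ?q v)"
    using edge_row_apply[OF assms, of p ?q] by simp
  then show ?thesis by (simp add: scaleR_diff_left[symmetric])
qed

text \<open>By polarization the inner products of differences, and so the entries of the Gram
  matrix, depend on pairwise distances alone. This carries rank from a generic placement to
  congruent ones.\<close>

lemma gram_det_edge_row_cong_dist:
  fixes p q :: "'v \<Rightarrow> real ^ 'd"
  assumes "finite V" "B \<subseteq> V \<times> V" and d: "\<And>u v. u \<in> V \<Longrightarrow> v \<in> V \<Longrightarrow> dist (q u) (q v) = dist (p u) (p v)"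
  shows "gram_det B (V \<times> UNIV) (edge_row q) = gram_det B (V \<times> UNIV) (edge_row p)"
proof -
  have pol: "(x - y) \<bullet> (x' - y') =
      ((dist x y')\<^sup>2 + (dist y x')\<^sup>2 - (dist x x')\<^sup>2 - (dist y y')\<^sup>2) / 2" for x y x' y' :: "real ^ 'd"
    by (simp add: dist_norm power2_norm_eq_inner inner_diff_left inner_diff_right inner_commute)
  have "finite B" using assms by (simp add: finite_subset)
  then show ?thesis unfolding gram_det_def
  proof (rule fdet_cong[rotated])
    fix s t assume "s \<in> B" "t \<in> B"
    then obtain u v u' v' where s: "s = (u, v)" "t = (u', v')" and V: "u \<in> V" "v \<in> V" "u' \<in> V" "v' \<in> V"
      using assms(2) by (cases s, cases t) auto
    show "(\<Sum>j\<in>V \<times> UNIV. edge_row q s j * edge_row q t j) = (\<Sum>j\<in>V \<times> UNIV. edge_row p s j * edge_row p t j)"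
      unfolding s sum_edge_row_edge_row[OF assms(1) V(1,2)] pol d[OF V(1) V(3)] d[OF V(1) V(4)]
        d[OF V(2) V(3)] d[OF V(2) V(4)] ..
  qed
qed

lemma config_poly_edge_row:
  assumes "e \<in> V \<times> V"
  shows "config_poly V (\<lambda>p. edge_row p e j)"
proof -
  obtain u v w c where [simp]: "e = (u, v)" "j = (w, c)" by (cases e, cases j) auto
  have "config_poly V (\<lambda>p. (of_bool (w = u) - of_bool (w = v)) * (p u $ c - p v $ c))"
    using assms by (intro config_poly_mult config_poly_diff config_poly_of_bool config_poly_coord) auto
  then show ?thesis by (simp add: edge_row_def)
qed

text \<open>If adding \<open>e\<close> to \<open>B\<close> gave independent rows at some
  \<open>x\<close>, it would by transfer do so at \<open>p\<close>, against maximality. So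
  \<open>B\<close> still spans the rows of \<open>S\<close> at every placement where it stays
  independent.\<close>

lemma generic_basis:
  fixes p :: "'v \<Rightarrow> real ^ 'd"
  assumes "generic V p" "finite V" "S \<subseteq> V \<times> V"
  obtains B where "B \<subseteq> S" "lin_indep B (V \<times> UNIV) (edge_row p)"
    "\<And>e (x :: 'v \<Rightarrow> real ^ 'd). e \<in> S \<Longrightarrow> e \<in> B \<or> \<not> lin_indep (insert e B) (V \<times> UNIV) (edge_row x)"
proof -
  have S: "finite S" using assms by (simp add: finite_subset)
  obtain B where B: "B \<subseteq> S" "lin_indep B (V \<times> UNIV) (edge_row p)"
    "\<And>e. e \<in> S \<Longrightarrow> e \<notin> B \<Longrightarrow> \<not> lin_indep (insert e B) (V \<times> UNIV) (edge_row p)"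
    using maximal_lin_indep_subset[OF S] by metis
  show ?thesis
  proof (rule that[OF B(1,2)])
    fix e and x :: "'v \<Rightarrow> real ^ 'd" assume e: "e \<in> S"
    have "lin_indep (insert e B) (V \<times> UNIV) (edge_row p)" if "lin_indep (insert e B) (V \<times> UNIV) (edge_row x)"
    proof (rule generic_lin_indep[where a = edge_row and q = x, OF assms(1) _ _ _ that])
      show "config_poly V (\<lambda>p. edge_row p s j)" if "s \<in> insert e B" for s j
        using that e B(1) assms(3) by (intro config_poly_edge_row) blast
    qed (use S B(1) assms(2) in \<open>auto intro: finite_subset\<close>)
    then show "e \<in> B \<or> \<not> lin_indep (insert e B) (V \<times> UNIV) (edge_row x)" using B(3) e by blast
  qed
qed

lemma velocity_closure:
  fixes x y :: "'v \<Rightarrow> real ^ 'd"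
  assumes "finite V" "B \<subseteq> V \<times> V" "lin_indep B (V \<times> UNIV) (edge_row x)"
    and dep: "(a, b) \<in> B \<or> \<not> lin_indep (insert (a, b) B) (V \<times> UNIV) (edge_row x)"
    and y: "\<And>u v. (u, v) \<in> B \<Longrightarrow> (x u - x v) \<bullet> (y u - y v) = 0"
    and ab: "a \<in> V" "b \<in> V"
  shows "(x a - x b) \<bullet> (y a - y b) = 0"
proof -
  have "(\<Sum>j\<in>V \<times> UNIV. edge_row x (a, b) j * (case j of (w, c) \<Rightarrow> y w $ c)) = 0"
  proof (rule orth_of_dependent_insert[OF assms(3) _ _ dep])
    fix s assume "s \<in> B"
    then obtain u v where s: "s = (u, v)" "u \<in> V" "v \<in> V" "(u, v) \<in> B" using assms(2) by (cases s) auto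
    then show "(\<Sum>j\<in>V \<times> UNIV. edge_row x s j * (case j of (w, c) \<Rightarrow> y w $ c)) = 0"
      using y edge_row_apply[OF assms(1) s(2,3), of x y] by simp
  qed (use assms in \<open>auto intro: finite_subset\<close>)
  then show ?thesis using edge_row_apply[OF assms(1) ab, of x y] by simp
qed

lemma inner_midpoint_eq_0_iff:
  fixes p q :: "'v \<Rightarrow> 'a::real_inner"
  shows "(midpoint (p u) (q u) - midpoint (p v) (q v)) \<bullet> ((q u - p u) - (q v - p v)) = 0 \<longleftrightarrow>
    dist (q u) (q v) = dist (p u) (p v)"
proof -
  have m: "midpoint (p u) (q u) - midpoint (p v) (q v) = (1/2) *\<^sub>R ((q u - q v) + (p u - p v))"
    by (simp add: midpoint_def scaleR_diff_right[symmetric] algebra_simps)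
  have "(q u - p u) - (q v - p v) = (q u - q v) - (p u - p v)" by simp
  then have *: "(midpoint (p u) (q u) - midpoint (p v) (q v)) \<bullet> ((q u - p u) - (q v - p v)) =
      ((dist (q u) (q v))\<^sup>2 - (dist (p u) (p v))\<^sup>2) / 2"
    unfolding m
    by (simp add: dist_norm power2_norm_eq_inner inner_add_left inner_add_right inner_diff_left
        inner_diff_right inner_commute)
  show ?thesis unfolding * by (simp add: power2_eq_iff_nonneg)
qed

text \<open>This is \<open>velocity_closure\<close> at the midpoint placement with the displacement
  \<open>q - p\<close> as velocity, which turns it into a statement about actual lengths.\<close>

lemma dist_closure:
  fixes p q :: "'v \<Rightarrow> real ^ 'd"
  assumes "finite V" "B \<subseteq> V \<times> V" "lin_indep B (V \<times> UNIV) (edge_row (\<lambda>w. midpoint (p w) (q w)))"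
    and "(a, b) \<in> B \<or> \<not> lin_indep (insert (a, b) B) (V \<times> UNIV) (edge_row (\<lambda>w. midpoint (p w) (q w)))"
    and "\<And>u v. (u, v) \<in> B \<Longrightarrow> dist (q u) (q v) = dist (p u) (p v)"
    and "a \<in> V" "b \<in> V"
  shows "dist (q a) (q b) = dist (p a) (p b)"
  using velocity_closure[OF assms(1-4), of "\<lambda>w. q w - p w"] assms(5-7)
  by (simp add: inner_midpoint_eq_0_iff)

section \<open>Rigidity and infinitesimal rigidity at generic placements\<close>

text \<open>Formulated without trivial motions, in parallel with \<open>rigid_framework\<close>.
  That such velocities come from skew maps at generic placements is shown in
  \<open>generic_velocity_is_rigid_motion\<close>.\<close>

definition inf_rigid :: "'v set \<Rightarrow> 'v set set \<Rightarrow> ('v \<Rightarrow> real ^ 'd) \<Rightarrow> bool" where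
  "inf_rigid V E p \<longleftrightarrow> (\<forall>q :: 'v \<Rightarrow> real ^ 'd.
     (\<forall>u v. {u, v} \<in> E \<longrightarrow> (p u - p v) \<bullet> (q u - q v) = 0) \<longrightarrow>
     (\<forall>u\<in>V. \<forall>v\<in>V. (p u - p v) \<bullet> (q u - q v) = 0))"

lemma continuous_on_gram_det_edge_row:
  assumes "finite V" "B \<subseteq> V \<times> V" "\<And>v. v \<in> V \<Longrightarrow> continuous_on U (\<lambda>t. x t v)"
  shows "continuous_on U (\<lambda>t. gram_det B (V \<times> UNIV) (edge_row (x t :: 'v \<Rightarrow> real ^ 'd)))"
proof (rule continuous_on_gram_det)
  fix s j assume "s \<in> B" "j \<in> V \<times> (UNIV :: 'd set)"
  then obtain u v w c where s: "s = (u, v)" "j = (w, c)" "u \<in> V" "v \<in> V"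
    using assms(2) by (cases s, cases j) auto
  show "continuous_on U (\<lambda>t. edge_row (x t) s j)"
    unfolding edge_row_def s prod.case
    by (intro continuous_intros assms(3) s(3,4))
qed (use assms in \<open>auto intro: finite_subset\<close>)

text \<open>The dual vector of a row, read as a velocity that stretches \<open>e\<close> and no
  other pair of \<open>S\<close>.\<close>

lemma dual_edge_vector_exists:
  fixes p :: "'v \<Rightarrow> real ^ 'd"
  assumes "finite V" "S \<subseteq> V \<times> V" "lin_indep S (V \<times> UNIV) (edge_row p)" "e \<in> S"
  shows "\<exists>w :: 'v \<Rightarrow> real ^ 'd. \<forall>(u, v)\<in>S. (p u - p v) \<bullet> (w u - w v) = of_bool ((u, v) = e)"
proof -
  have "finite S" using assms finite_subset by blast
  then obtain y where y: "\<forall>s\<in>S. (\<Sum>j\<in>V \<times> UNIV. edge_row p s j * y j) = of_bool (s = e)"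
    using dual_vector_exists[OF assms(3) _ _ assms(4)] assms(1) by auto
  define w where "w v = (\<chi> c. y (v, c))" for v
  have yw: "y j = (case j of (v, c) \<Rightarrow> w v $ c)" for j by (cases j) (simp add: w_def)
  have "(p u - p v) \<bullet> (w u - w v) = of_bool ((u, v) = e)" if "(u, v) \<in> S" for u v
    using edge_row_apply[OF assms(1), of u v p w] y[rule_format, OF that] that assms(2)
    unfolding yw[symmetric] by auto
  then show ?thesis by (intro exI[of _ w]) blast
qed

text \<open>The times at which the placement is congruent to \<open>p\<close> form a nonempty clopen
  subset of the interval. For openness, the midpoint of \<open>q t\<close> and a nearby
  \<open>q s\<close> keeps \<open>B\<close> independent, and then the edge lengths determine all
  distances.\<close>

lemma inf_rigid_imp_rigid:
  fixes p :: "'v \<Rightarrow> real ^ 'd"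
  assumes gen: "generic V p" and fin: "finite V" and E: "\<And>e. e \<in> E \<Longrightarrow> e \<subseteq> V" and inf: "inf_rigid V E p"
  shows "rigid_framework V E p"
  unfolding rigid_framework_def
proof (intro allI impI ballI)
  fix q :: "real \<Rightarrow> 'v \<Rightarrow> real ^ 'd" and t0 :: real and a0 b0
  assume cont: "\<forall>v\<in>V. continuous_on {0..1} (\<lambda>t. q t v)" and q0: "\<forall>v\<in>V. q 0 v = p v"
    and len: "\<forall>t\<in>{0..1}. \<forall>u v. {u, v} \<in> E \<longrightarrow> dist (q t u) (q t v) = dist (p u) (p v)"
    and t0: "t0 \<in> {0..1}" and ab0: "a0 \<in> V" "b0 \<in> V"
  let ?J = "V \<times> (UNIV :: 'd set)"
  define S where "S = {(u, v). {u, v} \<in> E}"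
  have S: "S \<subseteq> V \<times> V" unfolding S_def by (rule edge_pairs_subset[OF E])
  obtain B where B: "B \<subseteq> S" "lin_indep B ?J (edge_row p)"
    "\<And>e (x :: 'v \<Rightarrow> real ^ 'd). e \<in> S \<Longrightarrow> e \<in> B \<or> \<not> lin_indep (insert e B) ?J (edge_row x)"
    using generic_basis[OF gen fin S] by metis
  have BV: "B \<subseteq> V \<times> V" using B(1) S by blast
  have finB: "finite B" using BV fin by (simp add: finite_subset)
  \<comment> \<open>Wherever \<open>B\<close> is independent it spans the rows of all pairs, not
    only of edges: otherwise, at \<open>p\<close>, some velocity would stretch \<open>e\<close> but
    no pair of \<open>B\<close>, against \<open>inf\<close>.\<close>
  have dep: "e \<in> B \<or> \<not> lin_indep (insert e B) ?J (edge_row x)" if e: "e \<in> V \<times> V"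
    for e and x :: "'v \<Rightarrow> real ^ 'd"
  proof (rule ccontr)
    assume n: "\<not> (e \<in> B \<or> \<not> lin_indep (insert e B) ?J (edge_row x))"
    have ins: "lin_indep (insert e B) ?J (edge_row p)"
    proof (rule generic_lin_indep[where a = edge_row and q = x, OF gen])
      show "config_poly V (\<lambda>p. edge_row p s j)" if "s \<in> insert e B" for s j
        using that e BV by (intro config_poly_edge_row) blast
    qed (use n finB fin in auto)
    then obtain w :: "'v \<Rightarrow> real ^ 'd" where
      w: "\<forall>(u, v)\<in>insert e B. (p u - p v) \<bullet> (w u - w v) = of_bool ((u, v) = e)"
      using dual_edge_vector_exists[OF fin _ ins, of e] e BV by auto
    have "(p u - p v) \<bullet> (w u - w v) = 0" if "{u, v} \<in> E" for u v
      by (rule velocity_closure[OF fin BV B(2) B(3)])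
         (use w n that S in \<open>auto simp: S_def\<close>)
    then have "\<forall>u\<in>V. \<forall>v\<in>V. (p u - p v) \<bullet> (w u - w v) = 0"
      using inf unfolding inf_rigid_def by blast
    then show False using w e by (cases e) auto
  qed
  define T where "T = {t \<in> {0..1}. \<forall>u\<in>V. \<forall>v\<in>V. dist (q t u) (q t v) = dist (p u) (p v)}"
  have 0: "0 \<in> T" using q0 by (simp add: T_def)
  \<comment> \<open>All distance conditions are merged into the zero set of one continuous
    function.\<close>
  have "T = {t \<in> {0..1}. (\<Sum>u\<in>V. \<Sum>v\<in>V. \<bar>dist (q t u) (q t v) - dist (p u) (p v)\<bar>) = 0}"
    unfolding T_def using fin by (auto simp: sum_nonneg_eq_0_iff sum_nonneg)
  moreover have "closedin (top_of_set {0..1}) \<dots>"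
    by (intro continuous_closedin_preimage_constant continuous_intros) (use cont in auto)
  ultimately have clo: "closedin (top_of_set {0..1}) T" by simp
  have "\<exists>U. openin (top_of_set {0..1}) U \<and> t \<in> U \<and> U \<subseteq> T" if t: "t \<in> T" for t
  proof -
    define f where "f s = gram_det B ?J (edge_row (\<lambda>w. midpoint (q t w) (q s w)))" for s
    define U where "U = {0..1} \<inter> f -` (- {0})"
    have "continuous_on {0..1} f" unfolding f_def midpoint_def
      by (intro continuous_on_gram_det_edge_row fin BV continuous_intros) (use cont in auto)
    then have "openin (top_of_set {0..1}) U" unfolding U_def
      by (intro continuous_openin_preimage_gen) auto
    moreover have "f t = gram_det B ?J (edge_row p)"
      unfolding f_def midpoint_idem using t by (intro gram_det_edge_row_cong_dist fin BV) (auto simp: T_def)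
    then have "t \<in> U" using t B(2) gram_det_nonzero_iff[OF finB, of ?J "edge_row p"] fin by (simp add: U_def T_def)
    moreover have "U \<subseteq> T"
    proof
      fix s assume s: "s \<in> U"
      have "dist (q s u) (q s v) = dist (p u) (p v)" if uv: "u \<in> V" "v \<in> V" for u v
      proof -
        have "dist (q s u) (q s v) = dist (q t u) (q t v)"
        proof (rule dist_closure[OF fin BV])
          show "lin_indep B ?J (edge_row (\<lambda>w. midpoint (q t w) (q s w)))"
            using s gram_det_nonzero_iff[OF finB, of ?J] fin by (simp add: U_def f_def)
          show "dist (q s u) (q s v) = dist (q t u) (q t v)" if "(u, v) \<in> B" for u v
            using that B(1) len s t by (auto simp: S_def U_def T_def)
        qed (use uv dep in auto)
        then show ?thesis using t uv by (simp add: T_def)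
      qed
      then show "s \<in> T" using s by (simp add: T_def U_def)
    qed
    ultimately show ?thesis by blast
  qed
  then have "openin (top_of_set {0..1}) T" using openin_subopen[of "top_of_set {0..1::real}" T] by blast
  moreover have "connected {0..1::real}" by simp
  ultimately have "T = {0..1}" using clo 0 unfolding connected_clopen by blast
  then show "dist (q t0 a0) (q t0 b0) = dist (p a0) (p b0)" using t0 ab0 unfolding T_def by blast
qed

lemma abs_norm_power2_diff_le:
  fixes x y :: "'a::real_normed_vector"
  shows "\<bar>(norm x)\<^sup>2 - (norm y)\<^sup>2\<bar> \<le> (norm x + norm y) * norm (x - y)"
proof -
  have "(norm x)\<^sup>2 - (norm y)\<^sup>2 = (norm x + norm y) * (norm x - norm y)"
    by (simp add: power2_eq_square algebra_simps)
  then have "\<bar>(norm x)\<^sup>2 - (norm y)\<^sup>2\<bar> = (norm x + norm y) * \<bar>norm x - norm y\<bar>"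
    by (simp add: abs_mult)
  also have "\<dots> \<le> (norm x + norm y) * norm (x - y)"
    by (intro mult_left_mono norm_triangle_ineq3) simp
  finally show ?thesis .
qed

text \<open>Picard iteration for \<open>c = (t \<tau> b - N c) / 2\<close>, whose quadratic part \<open>N\<close> is a contraction
  near \<open>0\<close>.\<close>

lemma quadratic_system_path:
  fixes z :: "'e \<Rightarrow> 'e \<Rightarrow> 'b::real_normed_vector" and b :: "'e \<Rightarrow> real"
  assumes "finite S"
  obtains \<tau> c where "\<tau> > 0" "\<And>e. e \<in> S \<Longrightarrow> continuous_on {0..1} (\<lambda>t. c t e)"
    "\<And>e. e \<in> S \<Longrightarrow> c 0 e = (0 :: real)"
    "\<And>t e. t \<in> {0..1::real} \<Longrightarrow> e \<in> S \<Longrightarrow> 2 * c t e + (norm (\<Sum>f\<in>S. c t f *\<^sub>R z e f))\<^sup>2 = t * \<tau> * b e"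
proof -
  define M where "M = 1 + (\<Sum>e\<in>S. \<Sum>f\<in>S. norm (z e f))"
  have M: "M \<ge> 1" unfolding M_def by (simp add: sum_nonneg)
  have Me: "(\<Sum>f\<in>S. norm (z e f)) \<le> M" if "e \<in> S" for e
  proof -
    have "(\<Sum>f\<in>S. norm (z e f)) \<le> (\<Sum>e\<in>S. \<Sum>f\<in>S. norm (z e f))"
      by (rule member_le_sum[OF that]) (use assms in \<open>auto intro: sum_nonneg\<close>)
    then show ?thesis by (simp add: M_def)
  qed
  define L where "L e c = (\<Sum>f\<in>S. c f *\<^sub>R z e f)" for e c
  have L: "norm (L e c) \<le> D * M" if "e \<in> S" "\<And>f. f \<in> S \<Longrightarrow> \<bar>c f\<bar> \<le> D" "0 \<le> D" for e c D
  proof -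
    have "norm (L e c) \<le> (\<Sum>f\<in>S. D * norm (z e f))"
      unfolding L_def by (rule sum_norm_le) (use that in \<open>auto intro: mult_right_mono\<close>)
    also have "\<dots> \<le> D * M" unfolding sum_distrib_left[symmetric]
      using Me[OF that(1)] that(3) by (intro mult_left_mono)
    finally show ?thesis .
  qed
  have Ld: "L e c - L e c' = L e (\<lambda>f. c f - c' f)" for e c c'
    by (simp add: L_def scaleR_diff_left sum_subtractf)
  \<comment> \<open>On the ball of radius \<open>r\<close> in the maximum norm the quadratic part is
    1-Lipschitz; the division by 2 in the iteration makes the step a contraction with factor
    1/2.\<close>
  define r where "r = 1 / (2 * M\<^sup>2)"
  have r: "r > 0" "2 * M * r * M = 1" using M by (auto simp: r_def power2_eq_square)
  have N: "\<bar>(norm (L e c))\<^sup>2 - (norm (L e c'))\<^sup>2\<bar> \<le> D"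
    if "e \<in> S" "\<And>f. f \<in> S \<Longrightarrow> \<bar>c f\<bar> \<le> r" "\<And>f. f \<in> S \<Longrightarrow> \<bar>c' f\<bar> \<le> r"
      "\<And>f. f \<in> S \<Longrightarrow> \<bar>c f - c' f\<bar> \<le> D" "0 \<le> D" for e c c' D
  proof -
    have "\<bar>(norm (L e c))\<^sup>2 - (norm (L e c'))\<^sup>2\<bar> \<le> (norm (L e c) + norm (L e c')) * norm (L e c - L e c')"
      by (rule abs_norm_power2_diff_le)
    also have "\<dots> \<le> (r * M + r * M) * (D * M)"
      unfolding Ld using that r(1) M by (intro mult_mono add_mono L) auto
    also have "\<dots> = D * (2 * M * r * M)" by simp
    finally show ?thesis using r(2) by simp
  qed
  have N0: "(norm (L e c))\<^sup>2 \<le> r" if "e \<in> S" "\<And>f. f \<in> S \<Longrightarrow> \<bar>c f\<bar> \<le> r" for e c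
    using N[OF that(1), of c "\<lambda>_. 0" r] that r(1) by (simp add: L_def)
  \<comment> \<open>Small enough that the linear term is at most \<open>r\<close>, so that the
    iterates stay in the ball. The summand 1 keeps the denominator positive.\<close>
  define \<tau> where "\<tau> = r / (1 + (\<Sum>e\<in>S. \<bar>b e\<bar>))"
  have den: "1 + (\<Sum>e\<in>S. \<bar>b e\<bar>) \<ge> 1" by (simp add: sum_nonneg)
  then have den0: "1 + (\<Sum>e\<in>S. \<bar>b e\<bar>) \<noteq> 0" by linarith
  have \<tau>: "\<tau> > 0" unfolding \<tau>_def using r(1) den by (intro divide_pos_pos) linarith+
  have \<tau>b: "\<bar>t * \<tau> * b e\<bar> \<le> r" if "t \<in> {0..1}" "e \<in> S" for t e
  proof -
    have "\<bar>b e\<bar> \<le> (\<Sum>e\<in>S. \<bar>b e\<bar>)" by (rule member_le_sum) (use assms that in auto)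
    then have "\<tau> * \<bar>b e\<bar> \<le> \<tau> * (1 + (\<Sum>e\<in>S. \<bar>b e\<bar>))" using \<tau> by (intro mult_left_mono) auto
    also have "\<dots> = r" by (simp only: \<tau>_def times_divide_eq_left nonzero_mult_div_cancel_right[OF den0])
    finally have "t * (\<tau> * \<bar>b e\<bar>) \<le> 1 * r" using that(1) \<tau> by (intro mult_mono) auto
    then show ?thesis using that(1) \<tau> by (simp add: abs_mult)
  qed
  define u where "u = rec_nat (\<lambda>t e. 0 :: real) (\<lambda>k v t e. (t * \<tau> * b e - (norm (L e (v t)))\<^sup>2) / 2)"
  have u0: "u 0 t e = 0" for t e by (simp add: u_def)
  have uS: "u (Suc k) t e = (t * \<tau> * b e - (norm (L e (u k t)))\<^sup>2) / 2" for k t e by (simp add: u_def)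
  have bound: "\<bar>u k t e\<bar> \<le> r" if "t \<in> {0..1}" "e \<in> S" for k t e
    using that(2)
  proof (induction k arbitrary: e)
    case (Suc k)
    have "(norm (L e (u k t)))\<^sup>2 \<le> r" by (rule N0[OF Suc.prems Suc.IH])
    moreover have "\<bar>(x - y) / 2\<bar> \<le> r" if "\<bar>x\<bar> \<le> r" "0 \<le> y" "y \<le> r" for x y
      using that r(1) by (auto simp: abs_le_iff)
    ultimately show ?case unfolding uS using \<tau>b[OF that(1) Suc.prems] by simp
  qed (use r in \<open>simp add: u0\<close>)
  have step: "\<bar>u (Suc k) t e - u k t e\<bar> \<le> r * (1/2)^k" if "t \<in> {0..1}" "e \<in> S" for k t e
    using that(2)
  proof (induction k arbitrary: e)
    case 0
    then show ?case using bound[OF that(1) 0, of "Suc 0"] by (simp add: u0)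
  next
    case (Suc k)
    have 1: "\<bar>(norm (L e (u (Suc k) t)))\<^sup>2 - (norm (L e (u k t)))\<^sup>2\<bar> \<le> r * (1/2)^k"
      by (rule N[OF Suc.prems bound[OF that(1)] bound[OF that(1)] Suc.IH]) (use r(1) in auto)
    have 2: "u (Suc (Suc k)) t e - u (Suc k) t e =
        - ((norm (L e (u (Suc k) t)))\<^sup>2 - (norm (L e (u k t)))\<^sup>2) / 2"
      unfolding uS[of "Suc k"] uS[of k t e] by (simp add: field_simps)
    show ?case unfolding 2 using 1 by (simp add: abs_minus_commute)
  qed
  \<comment> \<open>The limit is written as a telescoping series, so that the M-test gives uniform
    convergence and hence continuity in \<open>t\<close>.\<close>
  define c where "c t e = suminf (\<lambda>k. u (Suc k) t e - u k t e)" for t e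
  have lim: "uniform_limit {0..1} (\<lambda>n t. u n t e) (\<lambda>t. c t e) sequentially" if e: "e \<in> S" for e
  proof -
    have "uniform_limit {0..1} (\<lambda>n t. \<Sum>k<n. u (Suc k) t e - u k t e) (\<lambda>t. c t e) sequentially"
      unfolding c_def
      by (rule Weierstrass_m_test[of _ _ "\<lambda>k. r * (1/2)^k"])
         (use step e in \<open>auto intro!: summable_mult summable_geometric\<close>)
    moreover have "(\<Sum>k<n. u (Suc k) t e - u k t e) = u n t e" for n t
      by (subst sum_lessThan_telescope) (simp add: u0)
    ultimately show ?thesis by simp
  qed
  have ucont: "continuous_on {0..1} (\<lambda>t. u n t e)" for n e
  proof (induction n arbitrary: e)
    case (Suc n)
    show ?case unfolding uS L_def by (intro continuous_intros Suc) auto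
  qed (simp add: u0)
  show ?thesis
  proof (rule that[OF \<tau>])
    show "continuous_on {0..1} (\<lambda>t. c t e)" if "e \<in> S" for e
      by (rule uniform_limit_theorem[OF _ lim[OF that]]) (use ucont in auto)
    have "u n 0 e = 0" for n e by (induction n arbitrary: e) (simp_all add: u0 uS L_def)
    then show "c 0 e = 0" for e by (simp add: c_def)
    show "2 * c t e + (norm (\<Sum>f\<in>S. c t f *\<^sub>R z e f))\<^sup>2 = t * \<tau> * b e"
      if t: "t \<in> {0..1}" and e: "e \<in> S" for t e
    proof -
      have l: "(\<lambda>n. u n t f) \<longlonglongrightarrow> c t f" if "f \<in> S" for f
        by (rule tendsto_uniform_limitI[OF lim[OF that] t])
      have "(\<lambda>n. u (Suc n) t e) \<longlonglongrightarrow> (t * \<tau> * b e - (norm (L e (c t)))\<^sup>2) / 2"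
        unfolding uS L_def by (intro tendsto_intros l) auto
      with LIMSEQ_Suc[OF l[OF e]] have "c t e = (t * \<tau> * b e - (norm (L e (c t)))\<^sup>2) / 2"
        by (rule LIMSEQ_unique)
      then show ?thesis by (simp add: L_def)
    qed
  qed
qed

text \<open>A velocity \<open>q0\<close> that preserves the edges but stretches the pair
  \<open>(a, b)\<close> makes the row of that pair independent of a basis \<open>B\<close> of the
  edge rows. A path is built that keeps the lengths in \<open>B\<close>, hence for small times all
  edge lengths, while \<open>(a, b)\<close> grows; this contradicts rigidity.\<close>

lemma rigid_imp_inf_rigid:
  fixes p :: "'v \<Rightarrow> real ^ 'd"
  assumes gen: "generic V p" and fin: "finite V" and E: "\<And>e. e \<in> E \<Longrightarrow> e \<subseteq> V"
    and rigid: "rigid_framework V E p"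
  shows "inf_rigid V E p"
  unfolding inf_rigid_def
proof (intro allI impI ballI, rule ccontr)
  fix q0 :: "'v \<Rightarrow> real ^ 'd" and a b
  assume q0: "\<forall>u v. {u, v} \<in> E \<longrightarrow> (p u - p v) \<bullet> (q0 u - q0 v) = 0"
    and ab: "a \<in> V" "b \<in> V" "(p a - p b) \<bullet> (q0 a - q0 b) \<noteq> 0"
  let ?J = "V \<times> (UNIV :: 'd set)"
  define S0 where "S0 = {(u, v). {u, v} \<in> E}"
  have S0: "S0 \<subseteq> V \<times> V" unfolding S0_def by (rule edge_pairs_subset[OF E])
  obtain B where B: "B \<subseteq> S0" "lin_indep B ?J (edge_row p)"
    "\<And>e (x :: 'v \<Rightarrow> real ^ 'd). e \<in> S0 \<Longrightarrow> e \<in> B \<or> \<not> lin_indep (insert e B) ?J (edge_row x)"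
    using generic_basis[OF gen fin S0] by metis
  have BV: "B \<subseteq> V \<times> V" using B(1) S0 by blast
  have finB: "finite B" using BV fin by (simp add: finite_subset)
  define S where "S = insert (a, b) B"
  have SV: "S \<subseteq> V \<times> V" and finS: "finite S" using BV ab finB by (auto simp: S_def)
  have abB: "(a, b) \<notin> B" using B(1) q0 ab(3) by (auto simp: S0_def)
  have ind: "lin_indep S ?J (edge_row p)" unfolding S_def
  proof (rule lin_indep_insertI[OF B(2) finB, of "\<lambda>(w, c). q0 w $ c"])
    fix s assume "s \<in> B"
    then obtain u v where "s = (u, v)" "u \<in> V" "v \<in> V" "{u, v} \<in> E"
      using BV B(1) by (cases s) (auto simp: S0_def)
    then show "(\<Sum>j\<in>?J. edge_row p s j * (case j of (w, c) \<Rightarrow> q0 w $ c)) = 0"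
      using q0 edge_row_apply[OF fin, of u v p q0] by simp
  qed (use edge_row_apply[OF fin ab(1,2), of p q0] ab(3) in simp)
  \<comment> \<open>Displacing \<open>p\<close> by a combination of dual velocities with
    coefficients \<open>c f\<close> changes the squared length of \<open>e\<close> by
    \<open>2 * c e\<close> plus a square, the form solved by
    \<open>quadratic_system_path\<close>.\<close>
  have "\<forall>e\<in>S. \<exists>w :: 'v \<Rightarrow> real ^ 'd. \<forall>(u, v)\<in>S. (p u - p v) \<bullet> (w u - w v) = of_bool ((u, v) = e)"
    using dual_edge_vector_exists[OF fin SV ind] by blast
  then obtain w :: "'v \<times> 'v \<Rightarrow> 'v \<Rightarrow> real ^ 'd" where
    w: "\<And>e u v. e \<in> S \<Longrightarrow> (u, v) \<in> S \<Longrightarrow> (p u - p v) \<bullet> (w e u - w e v) = of_bool ((u, v) = e)"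
    unfolding bchoice_iff by fast
  obtain \<tau> c where \<tau>: "\<tau> > 0" and cc: "\<And>e. e \<in> S \<Longrightarrow> continuous_on {0..1} (\<lambda>t. c t e)"
    and c0: "\<And>e. e \<in> S \<Longrightarrow> c 0 e = (0 :: real)"
    and c: "\<And>t e. t \<in> {0..1::real} \<Longrightarrow> e \<in> S \<Longrightarrow>
      2 * c t e + (norm (\<Sum>f\<in>S. c t f *\<^sub>R (w f (fst e) - w f (snd e))))\<^sup>2 = t * \<tau> * of_bool (e = (a, b))"
    by (rule quadratic_system_path[OF finS, of "\<lambda>e f. w f (fst e) - w f (snd e)" "\<lambda>e. of_bool (e = (a, b))"])
      (rule that)
  define x where "x t v = p v + (\<Sum>f\<in>S. c t f *\<^sub>R w f v)" for t v
  have x0: "x 0 v = p v" for v using c0 by (simp add: x_def)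
  have xc: "continuous_on {0..1} (\<lambda>t. x t v)" for v
    unfolding x_def by (intro continuous_intros cc)
  have xd: "(dist (x t u) (x t v))\<^sup>2 = (dist (p u) (p v))\<^sup>2 + t * \<tau> * of_bool ((u, v) = (a, b))"
    if t: "t \<in> {0..1}" and e: "(u, v) \<in> S" for t u v
  proof -
    define s where "s = (\<Sum>f\<in>S. c t f *\<^sub>R (w f u - w f v))"
    have "x t u - x t v = (p u - p v) + s"
      by (simp add: x_def s_def scaleR_diff_right sum_subtractf)
    then have "(dist (x t u) (x t v))\<^sup>2 = (dist (p u) (p v))\<^sup>2 + (2 * ((p u - p v) \<bullet> s) + (norm s)\<^sup>2)"
      by (simp add: dist_norm power2_norm_eq_inner inner_add_left inner_add_right inner_commute)
    also have "(p u - p v) \<bullet> s = (\<Sum>f\<in>S. if (u, v) = f then c t f else 0)"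
      unfolding s_def inner_sum_right inner_scaleR_right
      by (intro sum.cong refl) (use w e in auto)
    also have "\<dots> = c t (u, v)" using e finS by simp
    also have "2 * c t (u, v) + (norm s)\<^sup>2 = t * \<tau> * of_bool ((u, v) = (a, b))"
      using c[OF t e] by (simp add: s_def)
    finally show ?thesis .
  qed
  define f where "f t = gram_det B ?J (edge_row (\<lambda>w. midpoint (p w) (x t w)))" for t
  have fc: "continuous_on {0..1} f" unfolding f_def midpoint_def
    by (intro continuous_on_gram_det_edge_row fin BV continuous_intros xc)
  have f0: "f 0 \<noteq> 0"
    unfolding f_def x0 midpoint_idem using gram_det_nonzero_iff[OF finB, of ?J "edge_row p"] fin B(2) by auto
  obtain \<delta> where \<delta>: "\<delta> > 0" "\<And>t. t \<in> {0..1} \<Longrightarrow> dist t 0 < \<delta> \<Longrightarrow> dist (f t) (f 0) < \<bar>f 0\<bar>"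
    using fc[unfolded continuous_on_iff, THEN bspec[of _ _ 0], THEN spec[of _ "\<bar>f 0\<bar>"]] f0 by auto
  \<comment> \<open>Up to time \<open>h\<close> the function \<open>f\<close> does not vanish;
    running the path at speed \<open>h\<close> gives a motion on \<open>{0..1}\<close>.\<close>
  define h where "h = min 1 (\<delta> / 2)"
  have h: "0 < h" "h \<le> 1" "h < \<delta>" using \<delta>(1) by (auto simp: h_def min_def)
  have fn: "f t \<noteq> 0" if "0 \<le> t" "t \<le> h" for t
    using \<delta>(2)[of t] that h by (auto simp: dist_real_def)
  have th: "t * h \<in> {0..1}" "0 \<le> t * h" "t * h \<le> h" if "t \<in> {0..1}" for t
    using that h by (auto intro: mult_le_one mult_left_le_one_le)
  have "\<forall>t\<in>{0..1}. \<forall>u\<in>V. \<forall>v\<in>V. dist (x (t * h) u) (x (t * h) v) = dist (p u) (p v)"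
  proof (rule rigid[unfolded rigid_framework_def, THEN spec[of _ "\<lambda>t. x (t * h)"], THEN mp, THEN mp, THEN mp])
    show "\<forall>v\<in>V. continuous_on {0..1} (\<lambda>t. x (t * h) v)"
      by (intro ballI continuous_on_compose2[OF xc] continuous_intros) (use th in auto)
    show "\<forall>v\<in>V. x (0 * h) v = p v" by (simp add: x0)
    show "\<forall>t\<in>{0..1}. \<forall>u v. {u, v} \<in> E \<longrightarrow> dist (x (t * h) u) (x (t * h) v) = dist (p u) (p v)"
    proof (intro ballI allI impI)
      fix t :: real and u v assume t: "t \<in> {0..1}" and uv: "{u, v} \<in> E"
      have uv': "(u, v) \<in> S0" using uv by (simp add: S0_def)
      show "dist (x (t * h) u) (x (t * h) v) = dist (p u) (p v)"
      proof (rule dist_closure[OF fin BV _ B(3)[OF uv']])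
        show "lin_indep B ?J (edge_row (\<lambda>w. midpoint (p w) (x (t * h) w)))"
          using fn[OF th(2,3)[OF t]] gram_det_nonzero_iff[OF finB, of ?J] fin by (simp add: f_def)
        show "dist (x (t * h) u) (x (t * h) v) = dist (p u) (p v)" if "(u, v) \<in> B" for u v
        proof -
          have "(dist (x (t * h) u) (x (t * h) v))\<^sup>2 = (dist (p u) (p v))\<^sup>2"
            using xd[OF th(1)[OF t], of u v] that abB by (auto simp: S_def)
          then show ?thesis by (simp add: power2_eq_iff_nonneg)
        qed
      qed (use uv' S0 in auto)
    qed
  qed
  then have "dist (x h a) (x h b) = dist (p a) (p b)" using ab(1,2) by (auto dest!: bspec[of _ _ 1])
  moreover have "(dist (x h a) (x h b))\<^sup>2 = (dist (p a) (p b))\<^sup>2 + h * \<tau>"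
    using xd[of h a b] h by (simp add: S_def)
  ultimately show False using h \<tau> by simp
qed

section \<open>Velocities of complete graphs\<close>

text \<open>With \<open>\<pi>\<close> the orthogonal projection onto \<open>X\<close> and \<open>*\<close> the adjoint, the extension is
  \<open>A = f \<pi> - (f \<pi>)* (1 - \<pi>)\<close>.\<close>

lemma skew_map_extension:
  fixes f :: "'a::euclidean_space \<Rightarrow> 'a"
  assumes X: "subspace X" and f: "linear f" and skew: "\<And>x. x \<in> X \<Longrightarrow> f x \<bullet> x = 0"
  obtains A where "linear A" "\<And>x. x \<in> X \<Longrightarrow> A x = f x" "\<And>z. A z \<bullet> z = 0"
proof -
  obtain B where B: "B \<subseteq> X" "pairwise real_inner_class.orthogonal B" "\<And>b. b \<in> B \<Longrightarrow> norm b = 1" "independent B" "span B = X"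
    using orthonormal_basis_subspace[OF X] by metis
  have finB: "finite B" using B(4) independent_imp_finite by blast
  define \<pi> where "\<pi> z = (\<Sum>b\<in>B. (z \<bullet> b) *\<^sub>R b)" for z
  have \<pi>X: "\<pi> z \<in> X" for z
    unfolding \<pi>_def using X B(1) by (intro subspace_sum subspace_mul) auto
  have \<pi>b: "\<pi> z \<bullet> b = z \<bullet> b" if "b \<in> B" for z b
  proof -
    have "\<pi> z \<bullet> b = (\<Sum>b'\<in>B. if b' = b then z \<bullet> b else 0)"
      unfolding \<pi>_def inner_sum_left
    proof (intro sum.cong refl)
      fix b' assume "b' \<in> B"
      then show "((z \<bullet> b') *\<^sub>R b') \<bullet> b = (if b' = b then z \<bullet> b else 0)"
        using B(2,3) that by (auto simp: pairwise_def real_inner_class.orthogonal_def dot_square_norm)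
    qed
    then show ?thesis using that finB by simp
  qed
  have orth: "(z - \<pi> z) \<bullet> x = 0" if "x \<in> X" for z x
  proof -
    have "real_inner_class.orthogonal (z - \<pi> z) x"
      by (rule orthogonal_to_span[of x B]) (use B(5) that \<pi>b in \<open>auto simp: real_inner_class.orthogonal_def inner_diff_left\<close>)
    then show ?thesis by (simp add: real_inner_class.orthogonal_def)
  qed
  have \<pi>x: "\<pi> x = x" if "x \<in> X" for x
  proof -
    have "(x - \<pi> x) \<bullet> (x - \<pi> x) = 0" by (rule orth) (use that \<pi>X X in \<open>auto intro: subspace_diff\<close>)
    then show ?thesis by simp
  qed
  have lin\<pi>: "linear \<pi>" unfolding \<pi>_def
    by (intro linear_compose_sum ballI linearI) (auto simp: inner_add_left scaleR_add_left)
  define A where "A z = f (\<pi> z) - (\<Sum>b\<in>B. ((z - \<pi> z) \<bullet> f b) *\<^sub>R b)" for z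
  show ?thesis
  proof (rule that[of A])
    have "linear (\<lambda>z. \<Sum>b\<in>B. ((z - \<pi> z) \<bullet> f b) *\<^sub>R b)"
      by (intro linear_compose_sum ballI linearI)
         (auto simp: inner_add_left inner_diff_left scaleR_add_left scaleR_diff_left algebra_simps
            linear_add[OF lin\<pi>] linear_scale[OF lin\<pi>])
    moreover have "linear (\<lambda>z. f (\<pi> z))" using linear_compose[OF lin\<pi> f] by (simp add: o_def)
    ultimately show "linear A" unfolding A_def by (intro linear_compose_sub)
    show "A x = f x" if "x \<in> X" for x by (simp add: A_def \<pi>x[OF that])
    show "A z \<bullet> z = 0" for z
    proof -
      have "(\<Sum>b\<in>B. ((z - \<pi> z) \<bullet> f b) *\<^sub>R b) \<bullet> z = (z - \<pi> z) \<bullet> (\<Sum>b\<in>B. (z \<bullet> b) *\<^sub>R f b)"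
        by (simp add: inner_sum_left inner_sum_right inner_commute mult.commute)
      also have "(\<Sum>b\<in>B. (z \<bullet> b) *\<^sub>R f b) = f (\<pi> z)"
        by (simp add: \<pi>_def linear_sum[OF f] linear_scale[OF f])
      finally have "A z \<bullet> z = f (\<pi> z) \<bullet> \<pi> z"
        by (simp add: A_def inner_diff_left inner_diff_right inner_commute)
      then show ?thesis using skew \<pi>X by simp
    qed
  qed
qed

text \<open>A linear \<open>f\<close> is prescribed on a basis \<open>B\<close> taken from the
  \<open>x i\<close>, and \<open>xy\<close> makes it skew on the span. The assumption
  \<open>span\<close> gives \<open>f (x i) = y i\<close> for all \<open>i\<close>: if the family is
  independent, every \<open>x i\<close> is in \<open>B\<close>; if it spans, the difference is
  orthogonal to everything.\<close>

lemma skew_map_of_family: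
  fixes x y :: "'i \<Rightarrow> 'a::euclidean_space"
  assumes xy: "\<And>i j. i \<in> I \<Longrightarrow> j \<in> I \<Longrightarrow> x i \<bullet> y j + x j \<bullet> y i = 0"
    and span: "span (x ` I) = UNIV \<or> inj_on x I \<and> independent (x ` I)"
  obtains A where "linear A" "\<And>i. i \<in> I \<Longrightarrow> A (x i) = y i" "\<And>z. A z \<bullet> z = 0"
proof -
  obtain B where B: "B \<subseteq> x ` I" "independent B" "span B = span (x ` I)"
    by (metis maximal_independent_subset span_mono span_span subset_antisym)
  define idx where "idx = inv_into I x"
  have idx: "idx b \<in> I" "x (idx b) = b" if "b \<in> B" for b
    using that B(1) by (auto simp: idx_def inv_into_into f_inv_into_f)
  obtain f where f: "linear f" "\<And>b. b \<in> B \<Longrightarrow> f b = y (idx b)"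
    using linear_independent_extend[OF B(2), of "\<lambda>b. y (idx b)"] by blast
  have fi: "f u \<bullet> v + u \<bullet> f v = 0" if "u \<in> span B" "v \<in> span B" for u v
  proof -
    have "f b \<bullet> v + b \<bullet> f v = 0" if b: "b \<in> B" and v: "v \<in> span B" for b v
      using v
    proof (induction rule: span_induct_alt)
      case (step c a v)
      have "f b \<bullet> a + b \<bullet> f a = 0"
        using xy[OF idx(1)[OF b] idx(1)[OF step(1)]] idx(2) f(2) b step(1) by (simp add: inner_commute)
      then have "c * (f b \<bullet> a + b \<bullet> f a) = 0" by simp
      then show ?case using step(2)
        by (simp add: linear_add[OF f(1)] linear_scale[OF f(1)] inner_add_right ring_distribs)
    qed (simp add: linear_0[OF f(1)])
    note * = this
    from that(1) show ?thesis
    proof (induction rule: span_induct_alt)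
      case (step c a u)
      have "c * (f a \<bullet> v + a \<bullet> f v) = 0" using *[OF step(1) that(2)] by simp
      then show ?case using step(2)
        by (simp add: linear_add[OF f(1)] linear_scale[OF f(1)] inner_add_left ring_distribs)
    qed (simp add: linear_0[OF f(1)])
  qed
  have fx: "f (x i) = y i" if i: "i \<in> I" for i
    using span
  proof
    assume "inj_on x I \<and> independent (x ` I)"
    moreover from this have "x i \<in> B"
      by (metis B(1,3) i image_eqI span_superset spanning_subset_independent)
    ultimately show ?thesis using f(2) i by (simp add: idx_def inv_into_f_f)
  next
    assume U: "span (x ` I) = UNIV"
    have "real_inner_class.orthogonal (f (x i) - y i) v" if "v \<in> span B" for v
    proof (rule orthogonal_to_span[OF that])
      fix b assume b: "b \<in> B"
      have "f (x i) \<bullet> b = - (x i \<bullet> f b)" using fi[of "x i" b] U B(3) by auto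
      also have "\<dots> = y i \<bullet> b"
        using xy[OF i idx(1)[OF b]] idx(2)[OF b] f(2)[OF b] by (simp add: inner_commute)
      finally show "real_inner_class.orthogonal (f (x i) - y i) b" by (simp add: real_inner_class.orthogonal_def inner_diff_left)
    qed
    then have "real_inner_class.orthogonal (f (x i) - y i) (f (x i) - y i)" using U B(3) by blast
    then show ?thesis by (simp add: orthogonal_self)
  qed
  have "f u \<bullet> u = 0" if "u \<in> span B" for u using fi[OF that that] by (simp add: inner_commute)
  then obtain A where "linear A" "\<And>u. u \<in> span B \<Longrightarrow> A u = f u" "\<And>z. A z \<bullet> z = 0"
    using skew_map_extension[OF subspace_span f(1)] by metis
  then show ?thesis using that fx B(3) by (metis image_eqI span_base)
qed

section \<open>Differences of generic points\<close>

lemma lin_indep_imp_independent: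
  fixes x :: "'s \<Rightarrow> real ^ 'd"
  assumes ind: "lin_indep S UNIV (\<lambda>s c. x s $ c)" and fin: "finite S"
  shows "inj_on x S" "independent (x ` S)"
proof -
  have z: "c s = 0" if "(\<Sum>s\<in>S. c s *\<^sub>R x s) = 0" "s \<in> S" for c s
    by (rule lin_indepD[OF ind _ that(2)]) (use arg_cong[OF that(1), of "\<lambda>v. v $ j" for j] in simp)
  show inj: "inj_on x S"
  proof (rule inj_onI, rule ccontr)
    fix s t assume st: "s \<in> S" "t \<in> S" "x s = x t" "s \<noteq> t"
    have "(\<Sum>r\<in>S. (of_bool (r = s) - of_bool (r = t)) *\<^sub>R x r) =
        (\<Sum>r\<in>S. if r = s then x r else 0) - (\<Sum>r\<in>S. if r = t then x r else 0)"
      unfolding sum_subtractf[symmetric] by (intro sum.cong) auto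
    also have "\<dots> = 0" using st fin by simp
    finally show False using z[of "\<lambda>r. of_bool (r = s) - of_bool (r = t)" s] st by simp
  qed
  show "independent (x ` S)"
  proof (rule independent_if_scalars_zero)
    fix g v assume "(\<Sum>v\<in>x ` S. g v *\<^sub>R v) = 0" "v \<in> x ` S"
    then show "g v = 0" using z[of "\<lambda>s. g (x s)"] by (auto simp: sum.reindex[OF inj])
  qed (use fin in simp)
qed

text \<open>By transfer from the placement \<open>q\<close> with \<open>i\<close> at the origin and
  the points of \<open>S\<close> at distinct unit vectors of the axes.\<close>

lemma generic_differences_independent:
  fixes p :: "'v \<Rightarrow> real ^ 'd"
  assumes gen: "generic V p" and S: "finite S" "i \<in> V" "S \<subseteq> V - {i}" "card S \<le> CARD('d)"
  shows "inj_on (\<lambda>s. p s - p i) S" "independent ((\<lambda>s. p s - p i) ` S)"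
proof -
  obtain \<phi> :: "'v \<Rightarrow> 'd" where \<phi>: "inj_on \<phi> S"
    using card_le_inj[OF S(1) finite[of UNIV] S(4)] by blast
  define q :: "'v \<Rightarrow> real ^ 'd" where "q v = (if v = i then 0 else axis (\<phi> v) 1)" for v
  have "lin_indep S UNIV (\<lambda>s c. p s $ c - p i $ c)"
  proof (rule generic_lin_indep[where a = "\<lambda>p s c. p s $ c - p i $ c" and q = q, OF gen S(1)])
    show "config_poly V (\<lambda>p. p s $ j - p i $ j)" if "s \<in> S" for s j
      using that S by (intro config_poly_diff config_poly_coord) auto
    show "lin_indep S UNIV (\<lambda>s c. q s $ c - q i $ c)"
    proof (rule lin_indepI)
      fix c s assume c: "\<And>j. j \<in> UNIV \<Longrightarrow> (\<Sum>s\<in>S. c s * (q s $ j - q i $ j)) = 0" and s: "s \<in> S"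
      have "0 = (\<Sum>t\<in>S. c t * (q t $ \<phi> s - q i $ \<phi> s))" using c by simp
      also have "\<dots> = (\<Sum>t\<in>S. if t = s then c t else 0)"
        using \<phi> S(3) s by (intro sum.cong) (auto simp: q_def axis_def inj_on_def)
      also have "\<dots> = c s" using s S(1) by simp
      finally show "c s = 0" by simp
    qed
  qed simp
  then have ind: "lin_indep S UNIV (\<lambda>s c. (p s - p i) $ c)" by simp
  show "inj_on (\<lambda>s. p s - p i) S" "independent ((\<lambda>s. p s - p i) ` S)"
    using lin_indep_imp_independent[OF ind S(1)] by auto
qed

lemma generic_differences_span:
  fixes p :: "'v \<Rightarrow> real ^ 'd"
  assumes "generic V p" "i \<in> V" "S \<subseteq> V - {i}" "CARD('d) \<le> card S" "finite V"
  shows "span ((\<lambda>s. p s - p i) ` S) = UNIV"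
proof -
  obtain T where T: "T \<subseteq> S" "card T = CARD('d)" "finite T"
    using obtain_subset_with_card_n[OF assms(4)] by metis
  have inj: "inj_on (\<lambda>s. p s - p i) T" and ind: "independent ((\<lambda>s. p s - p i) ` T)"
    using generic_differences_independent[OF assms(1) T(3) assms(2)] T assms(3) by auto
  have "UNIV \<subseteq> span ((\<lambda>s. p s - p i) ` T)"
    by (rule card_ge_dim_independent[OF _ ind]) (use card_image[OF inj] T(2) in auto)
  then show ?thesis using span_mono[OF image_mono[OF T(1)], of "\<lambda>s. p s - p i"] by blast
qed

text \<open>With \<open>i\<close> moved to the origin, the conditions for the three pairs among
  \<open>s\<close>, \<open>t\<close> and \<open>i\<close> combine to the relation needed by
  \<open>skew_map_of_family\<close>. Differences of generic points are independent or span,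
  according to their number.\<close>

lemma generic_velocity_is_rigid_motion:
  fixes p q :: "'v \<Rightarrow> real ^ 'd"
  assumes gen: "generic V p" and fin: "finite V"
    and q: "\<And>u v. u \<in> V \<Longrightarrow> v \<in> V \<Longrightarrow> (p u - p v) \<bullet> (q u - q v) = 0"
  obtains A b where "linear A" "\<And>z. A z \<bullet> z = 0" "\<And>v. v \<in> V \<Longrightarrow> q v = A (p v) + b"
proof (cases "V = {}")
  case True
  show ?thesis by (rule that[of "\<lambda>_. 0" 0]) (use True in \<open>auto simp: linear_zero\<close>)
next
  case False
  then obtain i where i: "i \<in> V" by blast
  let ?x = "\<lambda>s. p s - p i" and ?y = "\<lambda>s. q s - q i"
  have xy: "?x s \<bullet> ?y t + ?x t \<bullet> ?y s = 0" if "s \<in> V - {i}" "t \<in> V - {i}" for s t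
    using q[of s t] q[of s i] q[of t i] that i
    by (simp add: inner_diff_left inner_diff_right inner_commute)
  have sp: "span (?x ` (V - {i})) = UNIV \<or> inj_on ?x (V - {i}) \<and> independent (?x ` (V - {i}))"
    using generic_differences_span[OF gen i, of "V - {i}"] fin
      generic_differences_independent[OF gen _ i, of "V - {i}"]
    by (cases "card (V - {i}) \<le> CARD('d)") auto
  obtain A where A: "linear A" "\<And>s. s \<in> V - {i} \<Longrightarrow> A (?x s) = ?y s" "\<And>z. A z \<bullet> z = 0"
    by (rule skew_map_of_family[of "V - {i}" ?x ?y, OF xy sp]) (assumption | rule that)+
  show ?thesis
  proof (rule that[OF A(1,3), of "q i - A (p i)"])
    show "q v = A (p v) + (q i - A (p i))" if "v \<in> V" for v
      using A(2)[of v] that by (cases "v = i") (auto simp: linear_diff[OF A(1)] algebra_simps)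
  qed
qed

section \<open>Paths and forests\<close>

lemma mg_linked_invariant:
  assumes "mg_linked ends A u v" and f: "\<And>e a b. e \<in> A \<Longrightarrow> ends e = {a, b} \<Longrightarrow> f a = f b"
  shows "f u = f v"
proof -
  obtain vs es where l: "length vs = Suc (length es)" and A: "set es \<subseteq> A"
    and e: "\<And>i. i < length es \<Longrightarrow> ends (es ! i) = {vs ! i, vs ! Suc i}"
    and uv: "hd vs = u" "last vs = v"
    using assms(1) unfolding mg_linked_def mg_path_def by blast
  have "f (vs ! i) = f (vs ! 0)" if "i \<le> length es" for i
    using that
  proof (induction i)
    case (Suc i)
    then show ?case using f[OF _ e[of i]] A by (metis Suc_le_lessD less_imp_le nth_mem subsetD)
  qed simp
  from this[of "length es"] show ?thesis
    using l uv by (metis One_nat_def diff_Suc_1 hd_conv_nth last_conv_nth le_refl length_0_conv nat.distinct(1))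
qed

lemma mg_linked_of_rtrancl:
  assumes "(u, v) \<in> {(a, b). {a, b} \<in> A}\<^sup>*"
  shows "mg_linked id A u v"
  using assms
proof (induction rule: rtrancl_induct)
  case base
  have "mg_path id A [u] []" by (simp add: mg_path_def)
  then show ?case unfolding mg_linked_def by (intro exI[of _ "[u]"] exI[of _ "[]"]) simp
next
  case (step y z)
  obtain vs es where p: "mg_path id A vs es" "hd vs = u" "last vs = y"
    using step.IH unfolding mg_linked_def by blast
  have ne: "vs \<noteq> []" and l: "length vs = Suc (length es)" using p(1) by (auto simp: mg_path_def)
  show ?case
  proof (cases "z \<in> set vs")
    \<comment> \<open>Paths have distinct vertices, so a path that returns to \<open>z\<close> is
      cut at its earlier visit.\<close>
    case True
    then obtain n where n: "n < length vs" "vs ! n = z" by (auto simp: in_set_conv_nth)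
    have "mg_path id A (take (Suc n) vs) (take n es)"
      using p(1) n l set_take_subset[of n es] unfolding mg_path_def by (auto simp: min_def)
    moreover have "hd (take (Suc n) vs) = u" using p(2) ne by (cases vs) auto
    moreover have "last (take (Suc n) vs) = z" using n by (simp add: take_Suc_conv_app_nth)
    ultimately show ?thesis unfolding mg_linked_def by blast
  next
    case False
    have y: "vs ! length es = y" using p(3) ne l by (simp add: last_conv_nth)
    have "mg_path id A (vs @ [z]) (es @ [{y, z}])"
      using p(1) False step(2) l y unfolding mg_path_def by (auto simp: nth_append less_Suc_eq)
    moreover have "hd (vs @ [z]) = u" using p(2) ne by simp
    ultimately show ?thesis unfolding mg_linked_def by (metis last_snoc)
  qed
qed

text \<open>A path from \<open>u\<close> to \<open>v\<close> avoiding the edge \<open>{u, v}\<close>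
  would close up to a cycle with it; the edges of the path are distinct because its vertices
  are.\<close>

lemma mg_forest_not_linked:
  assumes "mg_forest id F" "{u, v} \<in> F" "u \<noteq> v" "A \<subseteq> F - {{u, v}}"
  shows "\<not> mg_linked id A u v"
proof
  assume "mg_linked id A u v"
  then obtain vs es where l: "length vs = Suc (length es)" and dv: "distinct vs" and A: "set es \<subseteq> A"
    and e: "\<And>i. i < length es \<Longrightarrow> es ! i = {vs ! i, vs ! Suc i}"
    and uv: "hd vs = u" "last vs = v"
    unfolding mg_linked_def mg_path_def by auto
  have h: "vs ! 0 = u" "vs ! length es = v" using l uv by (auto simp: hd_conv_nth last_conv_nth simp flip: length_greater_0_conv)
  have "distinct es"
    unfolding distinct_conv_nth
  proof (intro allI impI notI)
    fix i j assume ij: "i < length es" "j < length es" "i \<noteq> j" "es ! i = es ! j"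
    have "vs ! i = vs ! j \<or> (vs ! i = vs ! Suc j \<and> vs ! Suc i = vs ! j)"
      using ij(4) e[OF ij(1)] e[OF ij(2)] by (metis doubleton_eq_iff)
    then show False using dv ij l by (auto simp: nth_eq_iff_index_eq)
  qed
  moreover have "{u, v} \<notin> set es" using A assms(4) by blast
  moreover have "(es @ [{u, v}]) ! i = {vs ! i, vs ! (Suc i mod length (es @ [{u, v}]))}"
    if "i < length (es @ [{u, v}])" for i
    using that e h by (cases "i = length es") (auto simp: nth_append)
  ultimately have "mg_cycle id F vs (es @ [{u, v}])"
    using l dv A assms(2,4) by (auto simp: mg_cycle_def)
  then show False using assms(1) unfolding mg_forest_def by blast
qed

text \<open>The components of \<open>F - T\<close> get pairwise distinct labels; as \<open>F\<close> is a forest, no edge of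
  \<open>T\<close> joins two vertices of the same component.\<close>

lemma forest_labelling:
  fixes F :: "'v set set"
  assumes F: "mg_forest id F" "\<And>e. e \<in> F \<Longrightarrow> e \<subseteq> V \<and> card e = 2" and V: "finite V"
  obtains h :: "'v \<Rightarrow> real" where "\<And>u v. {u, v} \<in> F \<Longrightarrow> h u = h v \<longleftrightarrow> {u, v} \<notin> T"
proof -
  define R where "R = {(a, b). {a, b} \<in> F - T}"
  have "sym R" by (auto simp: R_def sym_def insert_commute)
  then have symR: "sym (R\<^sup>*)" by (rule sym_rtrancl)
  define C where "C u = R\<^sup>* `` {u}" for u
  obtain g :: "'v set \<Rightarrow> nat" where g: "inj_on g (C ` V)"
    using finite_imp_inj_to_nat_seg[of "C ` V"] V by blast
  show ?thesis
  proof (rule that[of "\<lambda>u. real (g (C u))"])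
    fix u v assume uv: "{u, v} \<in> F"
    then have V: "u \<in> V" "v \<in> V" "u \<noteq> v" using F(2)[OF uv] by (auto simp: card_2_iff)
    have "C u = C v \<longleftrightarrow> {u, v} \<notin> T"
    proof
      assume "C u = C v"
      then have "(u, v) \<in> R\<^sup>*" by (auto simp: C_def)
      then have "mg_linked id (F - T) u v" unfolding R_def by (rule mg_linked_of_rtrancl)
      then show "{u, v} \<notin> T" using mg_forest_not_linked[OF F(1) uv V(3), of "F - T"] by blast
    next
      assume "{u, v} \<notin> T"
      then have "(u, v) \<in> R" using uv by (simp add: R_def)
      then have "(u, v) \<in> R\<^sup>*" "(v, u) \<in> R\<^sup>*" using symR by (auto simp: sym_def)
      then show "C u = C v" unfolding C_def by (auto intro: rtrancl_trans)
    qed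
    then show "real (g (C u)) = real (g (C v)) \<longleftrightarrow> {u, v} \<notin> T"
      using inj_on_eq_iff[OF g] V by simp
  qed
qed

text \<open>Coordinate \<open>\<beta> t\<close> of \<open>x\<close> is a labelling from
  \<open>forest_labelling\<close> that, among the edges of \<open>F\<close>, jumps exactly along
  \<open>T t\<close>. As the trees are disjoint, an edge of \<open>T t\<close> jumps in this
  coordinate only.\<close>

lemma forest_tree_directions:
  fixes F :: "'v set set" and \<beta> :: "nat \<Rightarrow> 'd::finite"
  assumes F: "mg_forest id F" "\<And>e. e \<in> F \<Longrightarrow> e \<subseteq> V \<and> card e = 2" and V: "finite V"
    and T: "\<And>t. t \<in> {1..CARD('d)} \<Longrightarrow> T t \<subseteq> F" "disjoint_family_on T {1..CARD('d)}"
    and \<beta>: "bij_betw \<beta> {1..CARD('d)} UNIV"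
  obtains x :: "'v \<Rightarrow> real ^ 'd" where
    "\<And>t u v. t \<in> {1..CARD('d)} \<Longrightarrow> {u, v} \<in> T t \<Longrightarrow> \<exists>r. r \<noteq> 0 \<and> x u - x v = r *\<^sub>R axis (\<beta> t) 1"
proof -
  have "\<forall>t. \<exists>h :: 'v \<Rightarrow> real. \<forall>u v. {u, v} \<in> F \<longrightarrow> (h u = h v \<longleftrightarrow> {u, v} \<notin> T t)"
    using forest_labelling[OF F V] by metis
  then obtain h :: "nat \<Rightarrow> 'v \<Rightarrow> real" where
    h: "\<And>t u v. {u, v} \<in> F \<Longrightarrow> h t u = h t v \<longleftrightarrow> {u, v} \<notin> T t"
    unfolding choice_iff by blast
  define i where "i = the_inv_into {1..CARD('d)} \<beta>"
  have i: "i (\<beta> t) = t" if "t \<in> {1..CARD('d)}" for t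
    unfolding i_def using \<beta> that by (intro the_inv_into_f_f) (auto simp: bij_betw_def)
  show ?thesis
  proof (rule that[of "\<lambda>v. \<chi> c. h (i c) v"])
    fix t u v assume t: "t \<in> {1..CARD('d)}" and uv: "{u, v} \<in> T t"
    have F: "{u, v} \<in> F" using T(1)[OF t] uv by blast
    have "h (i c) u - h (i c) v = (h t u - h t v) * axis (\<beta> t) 1 $ c" for c
    proof -
      obtain s where s: "s \<in> {1..CARD('d)}" "c = \<beta> s" using \<beta> by (metis UNIV_I bij_betw_def imageE)
      show ?thesis
      proof (cases "s = t")
        case False
        then have "{u, v} \<notin> T s" using T(2) s(1) t uv unfolding disjoint_family_on_def by blast
        then have "h s u = h s v" using h[OF F] by blast
        moreover have "\<beta> s \<noteq> \<beta> t" using False i[OF s(1)] i[OF t] by metis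
        ultimately show ?thesis by (simp add: s(2) i[OF s(1)] axis_def)
      qed (simp add: s(2) i[OF t] axis_def)
    qed
    then have "(\<chi> c. h (i c) u) - (\<chi> c. h (i c) v) = (h t u - h t v) *\<^sub>R axis (\<beta> t) 1"
      by (simp add: Finite_Cartesian_Product.vec_eq_iff)
    moreover have "h t u - h t v \<noteq> 0" using h[OF F] uv by simp
    ultimately show "\<exists>r. r \<noteq> 0 \<and> (\<chi> c. h (i c) u) - (\<chi> c. h (i c) v) = r *\<^sub>R axis (\<beta> t) 1" by blast
  qed
qed

section \<open>Velocities without momentum\<close>

text \<open>Column \<open>j\<close> is an edge, a translation or an infinitesimal rotation; the rows are independent iff
  no nonzero velocity preserves the lengths of the edges and has zero linear and angular momentum.
  Each edge \<open>e\<close> may be measured in a placement \<open>X e\<close> of its own, since in the limit of the clustered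
  placements the edges inside a cluster are rescaled.\<close>

definition motion_matrix ::
  "('v \<times> 'v \<Rightarrow> 'v \<Rightarrow> real ^ 'd) \<Rightarrow> ('v \<Rightarrow> real ^ 'd) \<Rightarrow> 'v \<times> 'd \<Rightarrow> ('v \<times> 'v) + 'd + ('d \<times> 'd) \<Rightarrow> real" where
  "motion_matrix X p = (\<lambda>(w, c) j. case j of
      Inl e \<Rightarrow> edge_row (X e) e (w, c)
    | Inr (Inl c') \<Rightarrow> of_bool (c = c')
    | Inr (Inr (c1, c2)) \<Rightarrow> p w $ c1 * of_bool (c = c2) - p w $ c2 * of_bool (c = c1))"

text \<open>A linear relation among the rows has one coefficient per point and axis, so it is read
  as a velocity \<open>q\<close>; its products with the columns are the stretching of edges, the
  linear momentum and the angular momentum.\<close>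

lemma lin_indep_motion_matrix_iff:
  fixes p :: "'v \<Rightarrow> real ^ 'd"
  assumes V: "finite V" "S \<subseteq> V \<times> V"
  shows "lin_indep (V \<times> UNIV) (S <+> UNIV) (motion_matrix X p) \<longleftrightarrow>
    (\<forall>q :: 'v \<Rightarrow> real ^ 'd.
      (\<forall>u v. (u, v) \<in> S \<longrightarrow> (X (u, v) u - X (u, v) v) \<bullet> (q u - q v) = 0) \<longrightarrow>
      (\<forall>c. (\<Sum>w\<in>V. q w $ c) = 0) \<longrightarrow>
      (\<forall>c1 c2. (\<Sum>w\<in>V. p w $ c1 * q w $ c2) = (\<Sum>w\<in>V. p w $ c2 * q w $ c1)) \<longrightarrow>
      (\<forall>v\<in>V. q v = 0))" (is "_ \<longleftrightarrow> (\<forall>q. ?Q q)")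
proof -
  define m where "m q j = (\<Sum>s\<in>V \<times> UNIV. (case s of (w, c) \<Rightarrow> q w $ c) * motion_matrix X p s j)"
    for q :: "'v \<Rightarrow> real ^ 'd" and j
  have m1: "m q (Inl (u, v)) = (X (u, v) u - X (u, v) v) \<bullet> (q u - q v)" if "(u, v) \<in> S" for q u v
  proof -
    have uv: "u \<in> V" "v \<in> V" using that V(2) by auto
    show ?thesis
      unfolding m_def edge_row_apply[OF V(1) uv, symmetric]
      by (intro sum.cong refl) (auto simp: motion_matrix_def)
  qed
  have m2: "m q (Inr (Inl c')) = (\<Sum>w\<in>V. q w $ c')" for q c'
  proof -
    have "m q (Inr (Inl c')) = (\<Sum>w\<in>V. \<Sum>c\<in>UNIV. q w $ c * of_bool (c = c'))"
      unfolding m_def sum.cartesian_product by (intro sum.cong refl) (auto simp: motion_matrix_def)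
    also have "\<dots> = (\<Sum>w\<in>V. \<Sum>c\<in>UNIV. if c = c' then q w $ c else 0)"
      by (intro sum.cong refl) auto
    finally show ?thesis by simp
  qed
  have m3: "m q (Inr (Inr (c1, c2))) = (\<Sum>w\<in>V. p w $ c1 * q w $ c2) - (\<Sum>w\<in>V. p w $ c2 * q w $ c1)" for q c1 c2
  proof -
    have "m q (Inr (Inr (c1, c2))) =
        (\<Sum>w\<in>V. \<Sum>c\<in>UNIV. (if c = c2 then p w $ c1 * q w $ c else 0) - (if c = c1 then p w $ c2 * q w $ c else 0))"
      unfolding m_def sum.cartesian_product
      by (intro sum.cong refl) (auto simp: motion_matrix_def algebra_simps)
    then show ?thesis by (simp add: sum_subtractf)
  qed
  have "((\<forall>j\<in>S <+> UNIV. m q j = 0) \<longrightarrow> (\<forall>v\<in>V. q v = 0)) = ?Q q" for q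
  proof -
    have "(\<forall>j\<in>S <+> UNIV. m q j = 0) \<longleftrightarrow>
      (\<forall>u v. (u, v) \<in> S \<longrightarrow> m q (Inl (u, v)) = 0) \<and> (\<forall>c. m q (Inr (Inl c)) = 0) \<and>
      (\<forall>c1 c2. m q (Inr (Inr (c1, c2))) = 0)"
      by (simp add: Plus_def ball_Un split_sum_all split_paired_All Ball_def image_iff)
    also have "\<dots> \<longleftrightarrow> (\<forall>u v. (u, v) \<in> S \<longrightarrow> (X (u, v) u - X (u, v) v) \<bullet> (q u - q v) = 0) \<and>
      (\<forall>c. (\<Sum>w\<in>V. q w $ c) = 0) \<and>
      (\<forall>c1 c2. (\<Sum>w\<in>V. p w $ c1 * q w $ c2) = (\<Sum>w\<in>V. p w $ c2 * q w $ c1))"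
      unfolding m2 m3 right_minus_eq
      by (intro conj_cong refl all_cong imp_cong) (simp add: m1)
    finally show ?thesis by (simp only: imp_conjL)
  qed
  note Q = this
  show ?thesis unfolding lin_indep_def Q[symmetric]
  proof (intro iffI allI impI)
    fix q :: "'v \<Rightarrow> real ^ 'd"
    assume h: "\<forall>c. (\<forall>j\<in>S <+> UNIV. (\<Sum>s\<in>V \<times> UNIV. c s * motion_matrix X p s j) = 0) \<longrightarrow> (\<forall>s\<in>V \<times> UNIV. c s = 0)"
      and q: "\<forall>j\<in>S <+> UNIV. m q j = 0"
    have "\<forall>s\<in>V \<times> UNIV. (case s of (w, c) \<Rightarrow> q w $ c) = 0"
      by (rule h[THEN spec[of _ "\<lambda>(w, c). q w $ c"], THEN mp, OF q[unfolded m_def]])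
    then show "\<forall>v\<in>V. q v = 0" by (auto simp: Finite_Cartesian_Product.vec_eq_iff)
  next
    fix c :: "'v \<times> 'd \<Rightarrow> real"
    assume h: "\<forall>q. (\<forall>j\<in>S <+> UNIV. m q j = 0) \<longrightarrow> (\<forall>v\<in>V. q v = 0)"
      and c: "\<forall>j\<in>S <+> UNIV. (\<Sum>s\<in>V \<times> UNIV. c s * motion_matrix X p s j) = 0"
    define q where "q w = (\<chi> i. c (w, i))" for w
    have cq: "c = (\<lambda>(w, i). q w $ i)" by (simp add: q_def fun_eq_iff)
    have "\<forall>j\<in>S <+> UNIV. m q j = 0" using c unfolding m_def cq .
    then have "\<forall>v\<in>V. q v = 0" using h by blast
    then show "\<forall>s\<in>V \<times> UNIV. c s = 0" unfolding cq by auto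
  qed
qed

text \<open>Subtracting from a velocity its projection onto translations and infinitesimal rotations
  removes the momenta without affecting the edge conditions. Independence makes the remainder zero
  on \<open>V\<close>, so the velocity preserves all distances.\<close>

lemma lin_indep_motion_matrix_imp_inf_rigid:
  fixes p :: "'v \<Rightarrow> real ^ 'd"
  assumes V: "finite V" and E: "\<And>e. e \<in> E \<Longrightarrow> e \<subseteq> V"
    and ind: "lin_indep (V \<times> UNIV) ({(u, v). {u, v} \<in> E} <+> UNIV) (motion_matrix (\<lambda>_. p) p)"
  shows "inf_rigid V E p"
  unfolding inf_rigid_def
proof (intro allI impI ballI)
  fix q :: "'v \<Rightarrow> real ^ 'd" and a b
  assume q: "\<forall>u v. {u, v} \<in> E \<longrightarrow> (p u - p v) \<bullet> (q u - q v) = 0" and ab: "a \<in> V" "b \<in> V"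
  \<comment> \<open>The momentum columns read as velocities: translations along the axes and
    infinitesimal rotations in the coordinate planes.\<close>
  define z :: "'d + 'd \<times> 'd \<Rightarrow> 'v \<Rightarrow> real ^ 'd" where
    "z k w = (\<chi> c. motion_matrix (\<lambda>_. p) p (w, c) (Inr k))" for k w
  have z1: "z (Inl c') w = axis c' 1" for c' w
    by (simp add: z_def motion_matrix_def Finite_Cartesian_Product.vec_eq_iff axis_def)
  have z2: "z (Inr (c1, c2)) w = p w $ c1 *\<^sub>R axis c2 1 - p w $ c2 *\<^sub>R axis c1 1" for c1 c2 w
    by (simp add: z_def motion_matrix_def Finite_Cartesian_Product.vec_eq_iff axis_def)
  have zp: "(p u - p v) \<bullet> (z k u - z k v) = 0" for k u v
  proof (cases k)
    case (Inr c)
    obtain c1 c2 where "c = (c1, c2)" by (cases c)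
    then show ?thesis unfolding Inr
      by (simp add: z2 inner_diff_right inner_axis algebra_simps)
  qed (simp add: z1)
  obtain e where e: "\<forall>t\<in>UNIV. (\<Sum>j\<in>V \<times> UNIV. ((case j of (w, c) \<Rightarrow> q w $ c) -
      (\<Sum>s\<in>UNIV. e s * (case j of (w, c) \<Rightarrow> z s w $ c))) * (case j of (w, c) \<Rightarrow> z t w $ c)) = 0"
    using orth_projection_exists[of "UNIV :: ('d + 'd \<times> 'd) set" "V \<times> (UNIV :: 'd set)"
        "\<lambda>(w, c). q w $ c" "\<lambda>k (w, c). z k w $ c"] V by auto
  define s where "s w = (\<Sum>k\<in>UNIV. e k *\<^sub>R z k w)" for w
  define q' where "q' w = q w - s w" for w
  have sp: "(p u - p v) \<bullet> (s u - s v) = 0" for u v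
  proof -
    have "s u - s v = (\<Sum>k\<in>UNIV. e k *\<^sub>R (z k u - z k v))"
      by (simp add: s_def scaleR_diff_right sum_subtractf)
    then show ?thesis by (simp add: inner_sum_right zp)
  qed
  have orth: "(\<Sum>w\<in>V. q' w \<bullet> z k w) = 0" for k
  proof -
    have "(\<Sum>w\<in>V. q' w \<bullet> z k w) = (\<Sum>(w, c)\<in>V \<times> UNIV. q' w $ c * z k w $ c)" by (rule sum_coords[symmetric])
    also have "\<dots> = (\<Sum>j\<in>V \<times> UNIV. ((case j of (w, c) \<Rightarrow> q w $ c) -
      (\<Sum>s\<in>UNIV. e s * (case j of (w, c) \<Rightarrow> z s w $ c))) * (case j of (w, c) \<Rightarrow> z k w $ c))"
      by (intro sum.cong refl) (auto simp: q'_def s_def)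
    finally show ?thesis using e by simp
  qed
  have 1: "(\<Sum>w\<in>V. q' w $ c) = 0" for c
    using orth[of "Inl c"] by (simp add: z1 inner_axis)
  have 2: "(\<Sum>w\<in>V. p w $ c1 * q' w $ c2) = (\<Sum>w\<in>V. p w $ c2 * q' w $ c1)" for c1 c2
    using orth[of "Inr (c1, c2)"] by (simp add: z2 inner_diff_right inner_axis sum_subtractf mult.commute)
  have 3: "(p u - p v) \<bullet> (q' u - q' v) = 0" if "{u, v} \<in> E" for u v
  proof -
    have "q' u - q' v = (q u - q v) - (s u - s v)" by (simp add: q'_def)
    then have "(p u - p v) \<bullet> (q' u - q' v) = (p u - p v) \<bullet> (q u - q v) - (p u - p v) \<bullet> (s u - s v)"
      by (simp only: inner_diff_right)
    then show ?thesis using q that sp[of u v] by simp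
  qed
  have S: "{(u, v). {u, v} \<in> E} \<subseteq> V \<times> V" by (rule edge_pairs_subset) (use E in blast)
  have "q' v = 0" if "v \<in> V" for v
    by (rule ind[unfolded lin_indep_motion_matrix_iff[OF V S], rule_format, of q'])
       (use 1 2 3 that in auto)
  then have "q v = s v" if "v \<in> V" for v using that by (simp add: q'_def)
  then show "(p a - p b) \<bullet> (q a - q b) = 0" using sp ab by simp
qed

lemma config_poly_motion_matrix:
  assumes "s \<in> V \<times> UNIV" "j \<in> S <+> UNIV" "S \<subseteq> V \<times> V"
  shows "config_poly V (\<lambda>p. motion_matrix (\<lambda>_. p) p s j)"
proof -
  obtain w c where s: "s = (w, c)" "w \<in> V" using assms(1) by auto
  show ?thesis
  proof (cases j)
    case (Inl e)
    then have "e \<in> V \<times> V" using assms(2,3) by auto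
    then have "config_poly V (\<lambda>p. edge_row p e (w, c))" by (rule config_poly_edge_row)
    then show ?thesis by (simp add: s(1) Inl motion_matrix_def)
  next
    case (Inr k)
    show ?thesis
    proof (cases k)
      case (Inl c')
      then show ?thesis by (simp add: s(1) \<open>j = Inr k\<close> motion_matrix_def)
    next
      case (Inr cc)
      obtain c1 c2 where cc: "cc = (c1, c2)" by (cases cc)
      have "config_poly V (\<lambda>p. p w $ c1 * of_bool (c = c2) - p w $ c2 * of_bool (c = c1))"
        by (intro config_poly_diff config_poly_mult config_poly_of_bool config_poly_coord s(2))
      then show ?thesis by (simp add: s(1) \<open>j = Inr k\<close> Inr cc motion_matrix_def)
    qed
  qed
qed

section \<open>Velocities of the limit of the clustered placements\<close>

text \<open>Each edge between \<open>P i\<close> and \<open>P s\<close> equates the components of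
  \<open>q\<close> at its ends along \<open>p s - p i\<close>, and so does each path. By genericity
  of \<open>p\<close> the available directions span the space.\<close>

lemma Q_edge_velocity_eq:
  fixes p :: "nat \<Rightarrow> real ^ 'd" and q :: "'v \<Rightarrow> real ^ 'd"
  assumes gen: "generic {1..m} p" and i: "i \<in> {1..m}"
    and cross: "\<And>s a b. s \<in> {1..m} - {i} \<Longrightarrow> a \<in> P i \<Longrightarrow> b \<in> P s \<Longrightarrow> {a, b} \<in> E \<Longrightarrow>
      (p s - p i) \<bullet> (q a - q b) = 0"
    and uv: "{u, v} \<in> Q_edges CARD('d) E m P i W"
  shows "q u = q v"
proof -
  have "q u' = q v'"
    if d: "CARD('d) \<le> card {s \<in> {1..m} - {i}. mg_linked id (edges_between E (P i) (P s)) u' v'}" for u' v'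
  proof -
    define S where "S = {s \<in> {1..m} - {i}. mg_linked id (edges_between E (P i) (P s)) u' v'}"
    have orth: "(q u' - q v') \<bullet> (p s - p i) = 0" if s: "s \<in> S" for s
    proof -
      have l: "mg_linked id (edges_between E (P i) (P s)) u' v'" and s': "s \<in> {1..m} - {i}"
        using s by (auto simp: S_def)
      have "(p s - p i) \<bullet> q u' = (p s - p i) \<bullet> q v'"
      proof (rule mg_linked_invariant[OF l])
        fix e a b assume "e \<in> edges_between E (P i) (P s)" "id e = {a, b}"
        then obtain a' b' where ab: "{a, b} = {a', b'}" "a' \<in> P i" "b' \<in> P s" "{a', b'} \<in> E"
          by (auto simp: edges_between_def)
        have "(p s - p i) \<bullet> q a' = (p s - p i) \<bullet> q b'"
          using cross[OF s' ab(2-4)] by (simp add: inner_diff_right)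
        then show "(p s - p i) \<bullet> q a = (p s - p i) \<bullet> q b"
          using ab(1) by (auto simp: doubleton_eq_iff)
      qed
      then show ?thesis by (simp add: inner_diff_right inner_commute)
    qed
    have span: "span ((\<lambda>s. p s - p i) ` S) = UNIV"
      by (rule generic_differences_span[OF gen i]) (use d in \<open>auto simp: S_def\<close>)
    have "real_inner_class.orthogonal (q u' - q v') (q u' - q v')"
      by (rule orthogonal_to_span[of _ "(\<lambda>s. p s - p i) ` S"])
         (use orth span in \<open>auto simp: real_inner_class.orthogonal_def\<close>)
    then show ?thesis by (simp add: orthogonal_self)
  qed
  moreover obtain u' v' where "{u, v} = {u', v'}"
    "CARD('d) \<le> card {s \<in> {1..m} - {i}. mg_linked id (edges_between E (P i) (P s)) u' v'}"
    using uv unfolding Q_edges_def by blast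
  ultimately show ?thesis by (metis doubleton_eq_iff)
qed

text \<open>Being constant on each part, \<open>g\<close> descends to the contracted multigraph,
  where it is constant along the edges of the connected \<open>T\<close>.\<close>

lemma contracted_tree_const:
  assumes conn: "mg_connected {1..k} (contract_ends k R) T" and part: "indexed_partition U k R"
    and T: "\<And>e. e \<in> T \<Longrightarrow> e \<subseteq> U \<and> card e = 2"
    and const: "\<And>j u v. j \<in> {1..k} \<Longrightarrow> u \<in> R j \<Longrightarrow> v \<in> R j \<Longrightarrow> g u = g v"
    and edge: "\<And>u v. {u, v} \<in> T \<Longrightarrow> g u = g v"
    and uv: "u \<in> U" "v \<in> U"
  shows "g u = g v"
proof -
  have ne: "R j \<noteq> {}" if "j \<in> {1..k}" for j using part that by (auto simp: indexed_partition_def)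
  have disj: "j = j'" if "j \<in> {1..k}" "j' \<in> {1..k}" "w \<in> R j" "w \<in> R j'" for j j' w
    using part that unfolding indexed_partition_def disjoint_family_on_def by blast
  have cover: "\<exists>j\<in>{1..k}. w \<in> R j" if "w \<in> U" for w
    using part that unfolding indexed_partition_def by blast
  define f where "f j = g (SOME w. w \<in> R j)" for j
  have f: "f j = g w" if "j \<in> {1..k}" "w \<in> R j" for j w
    unfolding f_def by (rule const[OF that(1) someI that(2)]) (rule that(2))
  have step: "f j = f j'" if e: "e \<in> T" and ends: "contract_ends k R e = {j, j'}" for e j j'
  proof -
    obtain a b where ab: "e = {a, b}" using T[OF e] by (auto simp: card_2_iff)
    obtain ja jb where j: "ja \<in> {1..k}" "a \<in> R ja" "jb \<in> {1..k}" "b \<in> R jb"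
      using cover[of a] cover[of b] T[OF e] ab by auto
    have "contract_ends k R e = {ja, jb}"
      unfolding contract_ends_def ab using j disj by blast
    then have "{j, j'} = {ja, jb}" using ends by simp
    moreover have "f ja = f jb" using f j edge e ab by metis
    ultimately show ?thesis by (auto simp: doubleton_eq_iff)
  qed
  obtain ju jv where j: "ju \<in> {1..k}" "u \<in> R ju" "jv \<in> {1..k}" "v \<in> R jv"
    using cover uv by metis
  have "mg_linked (contract_ends k R) T ju jv" using conn j by (auto simp: mg_connected_def)
  then have "f ju = f jv" by (rule mg_linked_invariant) (rule step)
  then show ?thesis using f j by simp
qed

text \<open>Take the inner product of \<open>q = A p + b\<close> with \<open>q\<close> and sum. The
  term with \<open>b\<close> vanishes with the linear momentum; the term with \<open>A\<close> pairs
  a skew matrix with \<open>M\<close>, which is symmetric by \<open>rot\<close>. Hence the squared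
  norms sum to zero.\<close>

lemma rigid_motion_orthogonal_zero:
  fixes p q :: "'v \<Rightarrow> real ^ 'd"
  assumes V: "finite V" and A: "linear A" "\<And>z. A z \<bullet> z = 0" and q: "\<And>v. v \<in> V \<Longrightarrow> q v = A (p v) + b"
    and tr: "\<And>c. (\<Sum>v\<in>V. q v $ c) = 0"
    and rot: "\<And>c1 c2. (\<Sum>v\<in>V. p v $ c1 * q v $ c2) = (\<Sum>v\<in>V. p v $ c2 * q v $ c1)"
    and v: "v \<in> V"
  shows "q v = 0"
proof -
  define a where "a c1 c2 = A (axis c1 1) $ c2" for c1 c2
  have skew: "a c1 c2 = - a c2 c1" for c1 c2
  proof -
    have "A (axis c1 1 + axis c2 1) \<bullet> (axis c1 1 + axis c2 1) = 0" by (rule A(2))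
    then have "A (axis c1 1) \<bullet> axis c2 1 + A (axis c2 1) \<bullet> axis c1 1 = 0"
      using A(2)[of "axis c1 1"] A(2)[of "axis c2 1"]
      by (simp add: linear_add[OF A(1)] inner_add_left inner_add_right)
    then show ?thesis by (simp add: a_def inner_axis)
  qed
  have Ap: "A z $ c = (\<Sum>c'\<in>UNIV. z $ c' * a c' c)" for z c
  proof -
    have "A z = A (\<Sum>c'\<in>UNIV. z $ c' *\<^sub>R axis c' 1)"
      using basis_expansion[of z] by (simp add: scalar_mult_eq_scaleR)
    then show ?thesis by (simp add: linear_sum[OF A(1)] linear_scale[OF A(1)] a_def)
  qed
  define M where "M c1 c2 = (\<Sum>v\<in>V. p v $ c1 * q v $ c2)" for c1 c2
  have b0: "(\<Sum>v\<in>V. b \<bullet> q v) = 0"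
  proof -
    have "(\<Sum>v\<in>V. q v) = 0" using tr by (simp add: Finite_Cartesian_Product.vec_eq_iff)
    then show ?thesis by (simp add: inner_sum_right[symmetric])
  qed
  have "(\<Sum>v\<in>V. A (p v) \<bullet> q v) = (\<Sum>v\<in>V. \<Sum>c\<in>UNIV. \<Sum>c'\<in>UNIV. a c' c * (p v $ c' * q v $ c))"
    by (simp add: inner_vec_def Ap sum_distrib_left sum_distrib_right ac_simps)
  also have "\<dots> = (\<Sum>c\<in>UNIV. \<Sum>v\<in>V. \<Sum>c'\<in>UNIV. a c' c * (p v $ c' * q v $ c))"
    by (rule sum.swap)
  also have "\<dots> = (\<Sum>c\<in>UNIV. \<Sum>c'\<in>UNIV. a c' c * M c' c)"
    unfolding M_def sum_distrib_left by (intro sum.cong refl sum.swap)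
  finally have S: "(\<Sum>v\<in>V. A (p v) \<bullet> q v) = (\<Sum>c\<in>UNIV. \<Sum>c'\<in>UNIV. a c' c * M c' c)" .
  have "(\<Sum>c\<in>UNIV. \<Sum>c'\<in>UNIV. a c' c * M c' c) = (\<Sum>c'\<in>UNIV. \<Sum>c\<in>UNIV. a c' c * M c' c)"
    by (rule sum.swap)
  also have "\<dots> = (\<Sum>c'\<in>UNIV. \<Sum>c\<in>UNIV. - (a c c' * M c c'))"
  proof (intro sum.cong refl)
    fix c c' show "a c' c * M c' c = - (a c c' * M c c')"
      using skew[of c' c] rot[of c' c] by (simp add: M_def)
  qed
  also have "\<dots> = - (\<Sum>c\<in>UNIV. \<Sum>c'\<in>UNIV. a c' c * M c' c)" by (simp add: sum_negf)
  finally have S0: "(\<Sum>c\<in>UNIV. \<Sum>c'\<in>UNIV. a c' c * M c' c) = 0" by simp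
  have "(\<Sum>v\<in>V. q v \<bullet> q v) = (\<Sum>v\<in>V. A (p v) \<bullet> q v + b \<bullet> q v)"
    by (intro sum.cong refl) (simp add: q inner_add_left)
  also have "\<dots> = 0" using S S0 b0 by (simp add: sum.distrib)
  finally show ?thesis using sum_nonneg_eq_0_iff[OF V, of "\<lambda>v. q v \<bullet> q v"] v by simp
qed

lemma continuous_on_motion_matrix:
  assumes "\<And>e v. e \<in> S \<Longrightarrow> v \<in> V \<Longrightarrow> continuous_on U (\<lambda>t. X t e v)"
    and "\<And>v. v \<in> V \<Longrightarrow> continuous_on U (\<lambda>t. p t v)"
    and "s \<in> V \<times> UNIV" "j \<in> S <+> UNIV" "S \<subseteq> V \<times> V"
  shows "continuous_on U (\<lambda>t. motion_matrix (X t) (p t) s j)"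
proof -
  obtain w c where s: "s = (w, c)" "w \<in> V" using assms(3) by auto
  show ?thesis
  proof (cases j)
    case (Inl e)
    then have e: "e \<in> S" using assms(4) by auto
    obtain u v where uv: "e = (u, v)" by (cases e)
    then have "u \<in> V" "v \<in> V" using e assms(5) by auto
    then have "continuous_on U (\<lambda>t. (of_bool (w = u) - of_bool (w = v)) * (X t e u $ c - X t e v $ c))"
      by (intro continuous_intros assms(1) e)
    then show ?thesis by (simp add: s(1) Inl uv motion_matrix_def edge_row_def)
  next
    case (Inr k)
    show ?thesis
    proof (cases k)
      case (Inl c')
      then show ?thesis by (simp add: s(1) \<open>j = Inr k\<close> motion_matrix_def)
    next
      case (Inr cc)
      obtain c1 c2 where cc: "cc = (c1, c2)" by (cases cc)
      have "continuous_on U (\<lambda>t. p t w $ c1 * of_bool (c = c2) - p t w $ c2 * of_bool (c = c1))"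
        by (intro continuous_intros assms(2) s(2))
      then show ?thesis by (simp add: s(1) \<open>j = Inr k\<close> Inr cc motion_matrix_def)
    qed
  qed
qed

text \<open>The limit \<open>\<epsilon> \<rightarrow> 0\<close> of the placements \<open>p (idx v) + \<epsilon> x v\<close>. The rows of the edges inside
  a cluster are divided by \<open>\<epsilon>\<close>, which gives their directions \<open>x u - x v\<close>.\<close>

lemma clustered_placement_motion_matrix:
  fixes P :: "nat \<Rightarrow> 'v set" and p :: "nat \<Rightarrow> real ^ 'd" and x :: "'v \<Rightarrow> real ^ 'd"
  assumes V: "finite V" and E: "\<And>e. e \<in> E \<Longrightarrow> e \<subseteq> V \<and> card e = 2"
    and P: "\<And>i. i \<in> {1..m} \<Longrightarrow> P i \<noteq> {}"
    and idx: "\<And>i v. i \<in> {1..m} \<Longrightarrow> v \<in> P i \<longleftrightarrow> v \<in> V \<and> idx v = i" "\<And>v. v \<in> V \<Longrightarrow> idx v \<in> {1..m}"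
    and R: "\<And>i. i \<in> {1..m} \<Longrightarrow> indexed_partition (P i) (k i) (R i)"
    and gen: "generic {1..m} p" and inf: "inf_rigid {1..m} (reduced_edges E m P) p"
    and T: "\<And>i t. i \<in> {1..m} \<Longrightarrow> t \<in> {1..CARD('d)} \<Longrightarrow>
      mg_connected {1..k i} (contract_ends (k i) (R i)) (T i t) \<and> T i t \<subseteq> induced_edges E (P i)"
    and \<beta>: "bij_betw \<beta> {1..CARD('d)} (UNIV :: 'd set)"
    and x: "\<And>i t u v. i \<in> {1..m} \<Longrightarrow> t \<in> {1..CARD('d)} \<Longrightarrow> {u, v} \<in> T i t \<Longrightarrow>
      \<exists>r. r \<noteq> 0 \<and> x u - x v = r *\<^sub>R axis (\<beta> t) 1"
    and Q: "\<And>i j. i \<in> {1..m} \<Longrightarrow> j \<in> {1..k i} \<Longrightarrow> mg_connected (R i j) id (Q_edges CARD('d) E m P i (R i j))"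
  shows "lin_indep (V \<times> UNIV) ({(u, v). {u, v} \<in> E} <+> UNIV)
    (motion_matrix (\<lambda>(u, v). if idx u = idx v then x else (\<lambda>w. p (idx w))) (\<lambda>w. p (idx w)))"
proof -
  have S: "{(u, v). {u, v} \<in> E} \<subseteq> V \<times> V" by (rule edge_pairs_subset) (use E in blast)
  show ?thesis unfolding lin_indep_motion_matrix_iff[OF V S]
  proof (intro allI impI ballI)
    fix q :: "'v \<Rightarrow> real ^ 'd" and v0
    assume q: "\<forall>u v. (u, v) \<in> {(u, v). {u, v} \<in> E} \<longrightarrow>
        ((case (u, v) of (u, v) \<Rightarrow> if idx u = idx v then x else (\<lambda>w. p (idx w))) u -
         (case (u, v) of (u, v) \<Rightarrow> if idx u = idx v then x else (\<lambda>w. p (idx w))) v) \<bullet> (q u - q v) = 0"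
      and tr: "\<forall>c. (\<Sum>w\<in>V. q w $ c) = 0"
      and rot: "\<forall>c1 c2. (\<Sum>w\<in>V. p (idx w) $ c1 * q w $ c2) = (\<Sum>w\<in>V. p (idx w) $ c2 * q w $ c1)"
      and v0: "v0 \<in> V"
    have q1: "(x u - x v) \<bullet> (q u - q v) = 0" if "{u, v} \<in> E" "idx u = idx v" for u v
      using q[rule_format, of u v] that by simp
    \<comment> \<open>For an edge inside a cluster the first factor is zero, so no case distinction
      is needed later.\<close>
    have q2: "(p (idx u) - p (idx v)) \<bullet> (q u - q v) = 0" if "{u, v} \<in> E" for u v
      using q[rule_format, of u v] that by (cases "idx u = idx v") auto
    have Rc: "q u = q v" if i: "i \<in> {1..m}" and j: "j \<in> {1..k i}" and uv: "u \<in> R i j" "v \<in> R i j" for i j u v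
    proof -
      have "mg_linked id (Q_edges CARD('d) E m P i (R i j)) u v"
        using Q[OF i j] uv by (auto simp: mg_connected_def)
      then show ?thesis
      proof (rule mg_linked_invariant)
        fix e a b assume "e \<in> Q_edges CARD('d) E m P i (R i j)" "id e = {a, b}"
        then have ab: "{a, b} \<in> Q_edges CARD('d) E m P i (R i j)" by simp
        show "q a = q b"
        proof (rule Q_edge_velocity_eq[OF gen i _ ab])
          fix s a b assume s: "s \<in> {1..m} - {i}" "a \<in> P i" "b \<in> P s" "{a, b} \<in> E"
          then have "idx a = i" "idx b = s" using idx(1) i by auto
          then have "(p i - p s) \<bullet> (q a - q b) = 0" using q2[OF s(4)] by simp
          then have "- ((p i - p s) \<bullet> (q a - q b)) = 0" by simp
          then show "(p s - p i) \<bullet> (q a - q b) = 0" by (simp flip: inner_minus_left)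
        qed
      qed
    qed
    \<comment> \<open>The tree in direction \<open>c = \<beta> t\<close> equates coordinate
      \<open>c\<close> of \<open>q\<close> across its edges; together with constancy on the parts
      \<open>R i j\<close>, this coordinate is constant on \<open>P i\<close>.\<close>
    have Pc: "q u = q v" if i: "i \<in> {1..m}" and uv: "u \<in> P i" "v \<in> P i" for i u v
    proof -
      have "q u $ c = q v $ c" for c
      proof -
        obtain t where t: "t \<in> {1..CARD('d)}" "c = \<beta> t" using \<beta> by (metis UNIV_I bij_betw_def imageE)
        have Tt: "mg_connected {1..k i} (contract_ends (k i) (R i)) (T i t)" "T i t \<subseteq> induced_edges E (P i)"
          using T[OF i t(1)] by auto
        show ?thesis
        proof (rule contracted_tree_const[OF Tt(1) R[OF i], where g = "\<lambda>w. q w $ c"])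
          show "e \<subseteq> P i \<and> card e = 2" if "e \<in> T i t" for e
            using that Tt(2) E by (auto simp: induced_edges_def)
          show "q a $ c = q b $ c" if ab: "{a, b} \<in> T i t" for a b
          proof -
            have "{a, b} \<in> E" "a \<in> P i" "b \<in> P i" using ab Tt(2) by (auto simp: induced_edges_def)
            then have "(x a - x b) \<bullet> (q a - q b) = 0" using q1 idx(1)[OF i] by auto
            moreover obtain r where "r \<noteq> 0" "x a - x b = r *\<^sub>R axis (\<beta> t) 1" using x[OF i t(1) ab] by blast
            ultimately have "axis (\<beta> t) 1 \<bullet> (q a - q b) = 0" by simp
            then show ?thesis by (simp add: inner_axis' t(2))
          qed
          show "q a $ c = q b $ c" if "j \<in> {1..k i}" "a \<in> R i j" "b \<in> R i j" for j a b
            using Rc[OF i that] by simp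
        qed (rule uv)+
      qed
      then show ?thesis by (simp add: Finite_Cartesian_Product.vec_eq_iff)
    qed
    \<comment> \<open>Constant on clusters, \<open>q\<close> induces a velocity \<open>y\<close> of
      the reduced graph at \<open>p\<close>. Infinitesimal rigidity there makes \<open>y\<close> an
      infinitesimal rigid motion, which the vanishing momenta force to be zero.\<close>
    define y where "y i = q (SOME v. v \<in> P i)" for i
    have y: "q v = y (idx v)" if v: "v \<in> V" for v
    proof -
      have i: "idx v \<in> {1..m}" by (rule idx(2)[OF v])
      have vP: "v \<in> P (idx v)" using idx(1)[OF i] v by simp
      then have "(SOME u. u \<in> P (idx v)) \<in> P (idx v)" by (rule someI)
      then show ?thesis unfolding y_def by (rule Pc[OF i vP])
    qed
    have "(p i - p s) \<bullet> (y i - y s) = 0" if red: "{i, s} \<in> reduced_edges E m P" for i s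
    proof -
      obtain i' s' where is': "{i, s} = {i', s'}" "i' \<in> {1..m}" "s' \<in> {1..m}" "edges_between E (P i') (P s') \<noteq> {}"
        using red unfolding reduced_edges_def by blast
      obtain a b where ab: "a \<in> P i'" "b \<in> P s'" "{a, b} \<in> E"
        using is'(4) unfolding edges_between_def by blast
      have "a \<in> V" "b \<in> V" "idx a = i'" "idx b = s'" using ab idx(1)[OF is'(2)] idx(1)[OF is'(3)] by auto
      then have "(p i' - p s') \<bullet> (y i' - y s') = 0" using q2[OF ab(3)] y by simp
      moreover have "i = i' \<and> s = s' \<or> i = s' \<and> s = i'" using is'(1) by (auto simp: doubleton_eq_iff)
      ultimately show ?thesis by (auto simp: inner_diff_left inner_diff_right)
    qed
    then have "\<forall>i\<in>{1..m}. \<forall>s\<in>{1..m}. (p i - p s) \<bullet> (y i - y s) = 0"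
      using inf unfolding inf_rigid_def by blast
    then have y0: "(p i - p s) \<bullet> (y i - y s) = 0" if "i \<in> {1..m}" "s \<in> {1..m}" for i s
      using that by blast
    obtain A b where A: "linear A" "\<And>z. A z \<bullet> z = 0" "\<And>i. i \<in> {1..m} \<Longrightarrow> y i = A (p i) + b"
      by (rule generic_velocity_is_rigid_motion[OF gen finite_atLeastAtMost y0]) (assumption | rule that)+
    show "q v0 = 0"
      by (rule rigid_motion_orthogonal_zero[OF V A(1,2), of q "\<lambda>w. p (idx w)" b])
         (use y A(3)[OF idx(2)] tr rot v0 in simp_all)
  qed
qed

section \<open>From the limit of the clustered placements to a generic placement\<close>

theorem theorem8p1:
  fixes V :: "'v set" and E :: "'v set set"
    and m :: nat and P :: "nat \<Rightarrow> 'v set"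
    and k :: "nat \<Rightarrow> nat" and R :: "nat \<Rightarrow> nat \<Rightarrow> 'v set"
  assumes "CARD('d::finite) \<ge> 1" and "m \<ge> CARD('d)"
    and "simple_graph V E"
    and "indexed_partition V m P"
    and "\<forall>i\<in>{1..m}. k i \<ge> 1 \<and> indexed_partition (P i) (k i) (R i)"
    and "d_rigid TYPE('d) {1..m} (reduced_edges E m P)"
    and "\<forall>i\<in>{1..m}. \<exists>F \<subseteq> induced_edges E (P i). mg_forest id F \<and>
           has_disjoint_spanning_trees CARD('d) {1..k i}
             (contract_ends (k i) (R i)) (contract_edges (k i) (R i) F)"
    and "\<forall>i\<in>{1..m}. \<forall>j\<in>{1..k i}. mg_connected (R i j) id (Q_edges CARD('d) E m P i (R i j))"
  shows "d_rigid TYPE('d) V E"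
proof -
  have V: "finite V" and E: "\<And>e. e \<in> E \<Longrightarrow> e \<subseteq> V \<and> card e = 2"
    using assms(3) by (auto simp: simple_graph_def)
  have P: "\<And>i. i \<in> {1..m} \<Longrightarrow> P i \<noteq> {}" "disjoint_family_on P {1..m}" "(\<Union>i\<in>{1..m}. P i) = V"
    using assms(4) by (auto simp: indexed_partition_def)
  define idx where "idx v = (SOME i. i \<in> {1..m} \<and> v \<in> P i)" for v
  have idx: "idx v \<in> {1..m} \<and> v \<in> P (idx v)" if "v \<in> V" for v
    unfolding idx_def by (rule someI_ex) (use that P(3) in blast)
  have idx_iff: "v \<in> P i \<longleftrightarrow> v \<in> V \<and> idx v = i" if i: "i \<in> {1..m}" for i v
  proof
    assume v: "v \<in> P i"
    then have "v \<in> V" using P(3) i by blast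
    moreover have "idx v = i"
      using idx[OF \<open>v \<in> V\<close>] v i P(2) unfolding disjoint_family_on_def by blast
    ultimately show "v \<in> V \<and> idx v = i" ..
  qed (use idx in blast)
  obtain p :: "nat \<Rightarrow> real ^ 'd" where gen: "generic {1..m} p"
    and "rigid_framework {1..m} (reduced_edges E m P) p"
    using assms(6) unfolding d_rigid_def by blast
  then have inf: "inf_rigid {1..m} (reduced_edges E m P) p"
    by (intro rigid_imp_inf_rigid) (auto simp: reduced_edges_def)
  obtain \<beta> :: "nat \<Rightarrow> 'd" where \<beta>: "bij_betw \<beta> {1..CARD('d)} UNIV"
    using ex_bij_betw_nat_finite_1[of "UNIV :: 'd set"] by auto
  \<comment> \<open>The trees and the axis-parallel coordinates of one cluster are packed together,
    so that a single choice for each cluster provides both.\<close>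
  define good where "good i T x \<longleftrightarrow> (\<forall>t\<in>{1..CARD('d)}.
      mg_connected {1..k i} (contract_ends (k i) (R i)) (T t) \<and> T t \<subseteq> induced_edges E (P i) \<and>
      (\<forall>u v. {u, v} \<in> T t \<longrightarrow> (\<exists>r. r \<noteq> 0 \<and> x u - x v = r *\<^sub>R axis (\<beta> t) 1)))"
    for i T and x :: "'v \<Rightarrow> real ^ 'd"
  have "\<exists>Tx. good i (fst Tx) (snd Tx)" if i: "i \<in> {1..m}" for i
  proof -
    obtain F where F: "F \<subseteq> induced_edges E (P i)" "mg_forest id F"
      and "has_disjoint_spanning_trees CARD('d) {1..k i} (contract_ends (k i) (R i)) (contract_edges (k i) (R i) F)"
      using assms(7)[rule_format, OF i] by blast
    then obtain T where T: "\<And>t. t \<in> {1..CARD('d)} \<Longrightarrow> mg_spanning_tree {1..k i} (contract_ends (k i) (R i))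
            (contract_edges (k i) (R i) F) (T t)" "disjoint_family_on T {1..CARD('d)}"
      unfolding has_disjoint_spanning_trees_def by blast
    have TF: "T t \<subseteq> F" if "t \<in> {1..CARD('d)}" for t
      using T(1)[OF that] by (auto simp: mg_spanning_tree_def contract_edges_def)
    have FV: "e \<subseteq> V \<and> card e = 2" if "e \<in> F" for e using that F(1) E by (auto simp: induced_edges_def)
    obtain x :: "'v \<Rightarrow> real ^ 'd" where
      "\<And>t u v. t \<in> {1..CARD('d)} \<Longrightarrow> {u, v} \<in> T t \<Longrightarrow> \<exists>r. r \<noteq> 0 \<and> x u - x v = r *\<^sub>R axis (\<beta> t) 1"
      by (rule forest_tree_directions[OF F(2) FV V TF T(2) \<beta>]) (assumption | rule that)+
    moreover have "mg_connected {1..k i} (contract_ends (k i) (R i)) (T t)" if "t \<in> {1..CARD('d)}" for t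
      using T(1)[OF that] unfolding mg_spanning_tree_def by blast
    ultimately have "good i T x" unfolding good_def using TF F(1) by blast
    then show ?thesis by (intro exI[of _ "(T, x)"]) simp
  qed
  then obtain T y where good: "\<And>i. i \<in> {1..m} \<Longrightarrow> good i (T i) (y i)"
    by (intro that[of "\<lambda>i. fst (SOME Tx. good i (fst Tx) (snd Tx))" "\<lambda>i. snd (SOME Tx. good i (fst Tx) (snd Tx))"])
       (rule someI_ex)
  have T: "mg_connected {1..k i} (contract_ends (k i) (R i)) (T i t) \<and> T i t \<subseteq> induced_edges E (P i)"
    if "i \<in> {1..m}" "t \<in> {1..CARD('d)}" for i t
    using good[OF that(1)] that(2) unfolding good_def by blast
  \<comment> \<open>The clusters are disjoint, so their coordinates glue to one function.\<close>
  define x where "x v = y (idx v) v" for v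
  have x: "\<exists>r. r \<noteq> 0 \<and> x u - x v = r *\<^sub>R axis (\<beta> t) 1"
    if "i \<in> {1..m}" "t \<in> {1..CARD('d)}" "{u, v} \<in> T i t" for i t u v
  proof -
    have "u \<in> P i" "v \<in> P i" using T[OF that(1,2)] that(3) by (auto simp: induced_edges_def)
    then have "idx u = i" "idx v = i" using idx_iff[OF that(1)] by auto
    moreover have "\<exists>r. r \<noteq> 0 \<and> y i u - y i v = r *\<^sub>R axis (\<beta> t) 1"
      using good[OF that(1)] that(2,3) unfolding good_def by blast
    ultimately show ?thesis by (simp add: x_def)
  qed
  let ?S = "{(u, v). {u, v} \<in> E}" and ?I = "V \<times> (UNIV :: 'd set)"
  have S: "?S \<subseteq> V \<times> V" by (rule edge_pairs_subset) (use E in blast)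
  have fin: "finite ?I" "finite (?S <+> (UNIV :: ('d + 'd \<times> 'd) set))"
    using V S by (auto intro: finite_subset)
  define pe where "pe \<epsilon> v = p (idx v) + \<epsilon> *\<^sub>R x v" for \<epsilon> v
  \<comment> \<open>Inside a cluster, differences in \<open>pe \<epsilon>\<close> are
    \<open>\<epsilon>\<close> times those in \<open>x\<close>. Measuring such an edge in
    \<open>x\<close> divides its row by \<open>\<epsilon>\<close>, so that it does not degenerate to
    zero at 0.\<close>
  define X where "X \<epsilon> = (\<lambda>(u, v). if idx u = idx v then x else pe \<epsilon>)" for \<epsilon>
  define f where "f \<epsilon> = gram_det ?I (?S <+> UNIV) (motion_matrix (X \<epsilon>) (pe \<epsilon>))" for \<epsilon>
  have "continuous_on UNIV f"
    unfolding f_def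
  proof (rule continuous_on_gram_det[OF fin(1)], rule continuous_on_motion_matrix[OF _ _ _ _ S])
    show "continuous_on UNIV (\<lambda>\<epsilon>. pe \<epsilon> v)" for v unfolding pe_def by (intro continuous_intros)
    then show "continuous_on UNIV (\<lambda>\<epsilon>. X \<epsilon> e v)" for e v
      by (cases e; cases "idx (fst e) = idx (snd e)") (simp_all add: X_def)
  qed
  then have cont: "isCont f 0" using continuous_on_eq_continuous_at[OF open_UNIV, of f] by blast
  have "lin_indep ?I (?S <+> UNIV)
    (motion_matrix (\<lambda>(u, v). if idx u = idx v then x else (\<lambda>w. p (idx w))) (\<lambda>w. p (idx w)))"
  proof (rule clustered_placement_motion_matrix[OF V E P(1) idx_iff _ _ gen inf T \<beta> x])
    show "idx v \<in> {1..m}" if "v \<in> V" for v using idx that by blast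
    show "indexed_partition (P i) (k i) (R i)" if "i \<in> {1..m}" for i using assms(5) that by blast
    show "mg_connected (R i j) id (Q_edges CARD('d) E m P i (R i j))" if "i \<in> {1..m}" "j \<in> {1..k i}" for i j
      using assms(8) that by blast
  qed
  moreover have pe0: "pe 0 = (\<lambda>w. p (idx w))" by (simp add: pe_def fun_eq_iff)
  moreover have "X 0 = (\<lambda>(u, v). if idx u = idx v then x else (\<lambda>w. p (idx w)))"
    unfolding X_def pe0 ..
  ultimately have "f 0 \<noteq> 0" unfolding f_def gram_det_nonzero_iff[OF fin] by (simp only:)
  with cont have "\<forall>\<^sub>F \<epsilon> in at 0. f \<epsilon> \<noteq> 0" unfolding isCont_def by (rule tendsto_imp_eventually_ne)
  then obtain \<delta> where "\<delta> > 0" "\<And>\<epsilon>. \<epsilon> \<noteq> 0 \<Longrightarrow> dist \<epsilon> 0 < \<delta> \<Longrightarrow> f \<epsilon> \<noteq> 0"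
    by (auto simp: eventually_at)
  then have "\<delta> / 2 \<noteq> 0" "f (\<delta> / 2) \<noteq> 0" by (auto simp: dist_real_def)
  then obtain \<epsilon> where \<epsilon>: "\<epsilon> \<noteq> 0" "f \<epsilon> \<noteq> 0" by blast
  \<comment> \<open>As \<open>\<epsilon> \<noteq> 0\<close>, undoing the rescaling inside clusters
    does not change which velocities satisfy the edge conditions.\<close>
  have "lin_indep ?I (?S <+> UNIV) (motion_matrix (\<lambda>_. pe \<epsilon>) (pe \<epsilon>))"
    unfolding lin_indep_motion_matrix_iff[OF V S]
  proof (intro allI impI)
    fix q :: "'v \<Rightarrow> real ^ 'd"
    assume q: "\<forall>u v. (u, v) \<in> ?S \<longrightarrow> (pe \<epsilon> u - pe \<epsilon> v) \<bullet> (q u - q v) = 0"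
      and tr: "\<forall>c. (\<Sum>w\<in>V. q w $ c) = 0"
      and rot: "\<forall>c1 c2. (\<Sum>w\<in>V. pe \<epsilon> w $ c1 * q w $ c2) = (\<Sum>w\<in>V. pe \<epsilon> w $ c2 * q w $ c1)"
    have "(X \<epsilon> (u, v) u - X \<epsilon> (u, v) v) \<bullet> (q u - q v) = 0" if uv: "(u, v) \<in> ?S" for u v
    proof (cases "idx u = idx v")
      case True
      then have "pe \<epsilon> u - pe \<epsilon> v = \<epsilon> *\<^sub>R (x u - x v)" by (simp add: pe_def scaleR_diff_right)
      then have "\<epsilon> * ((x u - x v) \<bullet> (q u - q v)) = 0" using q[rule_format, OF uv] by simp
      then show ?thesis using True \<epsilon>(1) by (simp add: X_def)
    qed (use q uv in \<open>simp add: X_def\<close>)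
    note X = this
    have ind: "lin_indep ?I (?S <+> UNIV) (motion_matrix (X \<epsilon>) (pe \<epsilon>))"
      using \<epsilon>(2) unfolding f_def gram_det_nonzero_iff[OF fin] .
    show "\<forall>v\<in>V. q v = 0"
      by (rule ind[unfolded lin_indep_motion_matrix_iff[OF V S], THEN spec[of _ q], THEN mp, THEN mp, THEN mp])
         (use X tr rot in auto)
  qed
  moreover obtain p' :: "'v \<Rightarrow> real ^ 'd" where gen': "generic V p'"
    by (rule generic_exists[OF V])
  \<comment> \<open>The placement \<open>pe \<epsilon>\<close> need not be generic; independence is
    transferred from it to \<open>p'\<close>.\<close>
  ultimately have "lin_indep ?I (?S <+> UNIV) (motion_matrix (\<lambda>_. p') p')"
    by (intro generic_lin_indep[where a = "\<lambda>p. motion_matrix (\<lambda>_. p) p" and q = "pe \<epsilon>", OF gen' fin])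
       (rule config_poly_motion_matrix[OF _ _ S])
  then have "inf_rigid V E p'"
    using lin_indep_motion_matrix_imp_inf_rigid[OF V] E by blast
  then have "rigid_framework V E p'"
    using E by (intro inf_rigid_imp_rigid[OF gen' V]) auto
  then show ?thesis unfolding d_rigid_def using gen' by blast
qed

end
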